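(* $\mathcal{C}(3,3)=\{P,Q\}$ (up to isomorphism), where $P$ is the Petersen graph and $Q$ is the graph defined below.
   Context: All graphs are finite and simple. A graph is $K_3$-saturated if it is triangle-free but adding any new edge creates a triangle. A blow-up of a graph $H$ replaces each vertex by a positive number of copies, copies being adjacent iff the original vertices are adjacent; blowing up a set of vertices means doing this for vertices in that set only. Let $c(3,3)=\max\{3|G|-e(G): G \text{ is } K_3\text{-saturated}, \delta(G)=3\}$ (this maximum exists and equals 15). $\mathcal{C}(3,3)$ is the collection of $K_3$-saturated graphs $G$ with $\delta(G)=3$ and $e(G)=3|G|-c(3,3)$ which cannot be obtained from a smaller $K_3$-saturated graph $H$ with $\delta(H)=3$ and $e(H)=3|H|-c(3,3)$ by blowing up pairwise non-adjacent vertices of $H$ of degree $3$. The Petersen graph $P$ can be described as the graph on vertices $s,x_1,x_2,x_3,y_1,y_2,y_3,z_1,z_2,z_3$ where $s$ is adjacent to each $x_i$, each $x_i$ is adjacent to $y_i$ and $z_i$, $y_i$ is adjacent to $z_j$ for all $i\ne j$, and there are no other edges. $Q$ is the graph with the same description but with indices ranging over $\{1,2,3,4\}$ (so $|Q|=13$, $e(Q)=24$). *)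

theory Defs
  imports "Graph_Theory.Graph_Theory"
begin

text \<open>A finite simple graph is a \<^locale>\<open>pair_graph\<close>: a finite, loop-free digraph whose arc set is a
  symmetric set of ordered pairs. Every undirected edge is thus represented by two arcs, and the
  degree of a vertex is its out-degree.\<close>

definition num_edges :: "'a pair_pre_digraph \<Rightarrow> nat" where
  "num_edges G = card ((\<lambda>(u, v). {u, v}) ` parcs G)"

abbreviation degree :: "'a pair_pre_digraph \<Rightarrow> 'a \<Rightarrow> nat" where
  "degree G v \<equiv> out_degree (with_proj G) v"

text \<open>The case distinction only fixes a value for the graph without vertices, where \<^const>\<open>Min\<close> would
  be unspecified.\<close>

definition min_degree :: "'a pair_pre_digraph \<Rightarrow> nat" where
  "min_degree G = (if pverts G = {} then 0 else Min (degree G ` pverts G))"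

definition triangle_free :: "'a pair_pre_digraph \<Rightarrow> bool" where
  "triangle_free G \<longleftrightarrow> \<not> (\<exists>u v w. (u, v) \<in> parcs G \<and> (v, w) \<in> parcs G \<and> (w, u) \<in> parcs G)"

definition add_edge :: "'a \<Rightarrow> 'a \<Rightarrow> 'a pair_pre_digraph \<Rightarrow> 'a pair_pre_digraph" where
  "add_edge u v G = G\<lparr>parcs := parcs G \<union> {(u, v), (v, u)}\<rparr>"

definition K3_saturated :: "'a pair_pre_digraph \<Rightarrow> bool" where
  "K3_saturated G \<longleftrightarrow> pair_graph G \<and> triangle_free G \<and>
     (\<forall>u\<in>pverts G. \<forall>v\<in>pverts G. u \<noteq> v \<and> (u, v) \<notin> parcs G \<longrightarrow> \<not> triangle_free (add_edge u v G))"

definition weight :: "'a pair_pre_digraph \<Rightarrow> int" where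
  "weight G = 3 * int (card (pverts G)) - int (num_edges G)"

text \<open>Taking the maximum over graphs with vertices in \<^typ>\<open>nat\<close> is no restriction, since every finite
  graph is isomorphic to such a graph.\<close>

definition c33 :: int where
  "c33 = (GREATEST c. \<exists>G :: nat pair_pre_digraph.
            K3_saturated G \<and> min_degree G = 3 \<and> c = weight G)"

text \<open>The blow-up of \<open>H\<close> in which the vertex \<open>v\<close> is replaced by \<open>m v\<close> copies.\<close>

definition blow_up :: "('a \<Rightarrow> nat) \<Rightarrow> 'a pair_pre_digraph \<Rightarrow> ('a \<times> nat) pair_pre_digraph" where
  "blow_up m H = \<lparr> pverts = (SIGMA v:pverts H. {..<m v}),
     parcs = {((u, i), (v, j)) |u i v j. (u, v) \<in> parcs H \<and> i < m u \<and> j < m v} \<rparr>"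

abbreviation graph_iso :: "'a pair_pre_digraph \<Rightarrow> 'b pair_pre_digraph \<Rightarrow> bool" where
  "graph_iso G H \<equiv> digraph_iso (with_proj G) (with_proj H)"

definition blow_up_of_set :: "'a pair_pre_digraph \<Rightarrow> 'b pair_pre_digraph \<Rightarrow> 'b set \<Rightarrow> bool" where
  "blow_up_of_set G H S \<longleftrightarrow>
     (\<exists>m. (\<forall>v\<in>pverts H. 0 < m v) \<and> (\<forall>v\<in>pverts H - S. m v = 1) \<and> graph_iso G (blow_up m H))"

text \<open>As above, \<open>H\<close> ranges over all finite graphs up to isomorphism.\<close>

definition C33 :: "'a pair_pre_digraph set" where
  "C33 = {G. K3_saturated G \<and> min_degree G = 3 \<and>
      int (num_edges G) = 3 * int (card (pverts G)) - c33 \<and>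
      \<not> (\<exists>(H :: nat pair_pre_digraph) S.
            K3_saturated H \<and> min_degree H = 3 \<and>
            int (num_edges H) = 3 * int (card (pverts H)) - c33 \<and>
            card (pverts H) < card (pverts G) \<and>
            S \<subseteq> pverts H \<and>
            (\<forall>u\<in>S. \<forall>v\<in>S. (u, v) \<notin> parcs H) \<and>
            (\<forall>v\<in>S. degree H v = 3) \<and>
            blow_up_of_set G H S)}"

datatype sxyz = Vs | Vx nat | Vy nat | Vz nat

definition sxyz_graph :: "nat \<Rightarrow> sxyz pair_pre_digraph" where
  "sxyz_graph n =
     (let A = {(Vs, Vx i) |i. i \<in> {1..n}} \<union> {(Vx i, Vy i) |i. i \<in> {1..n}} \<union>
              {(Vx i, Vz i) |i. i \<in> {1..n}} \<union>
              {(Vy i, Vz j) |i j. i \<in> {1..n} \<and> j \<in> {1..n} \<and> i \<noteq> j}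
      in \<lparr> pverts = {Vs} \<union> Vx ` {1..n} \<union> Vy ` {1..n} \<union> Vz ` {1..n}, parcs = A \<union> A\<inverse> \<rparr>)"

definition P_graph :: "sxyz pair_pre_digraph" where
  "P_graph = sxyz_graph 3"

definition Q_graph :: "sxyz pair_pre_digraph" where
  "Q_graph = sxyz_graph 4"

end

theory Submission
  imports Defs
begin

text \<open>Let \<open>v\<close> be a vertex of degree 3 with neighbours \<open>a, b, c\<close>, and sort the other vertices by their
  neighbours among \<open>a, b, c\<close>. Let \<open>A\<close>, \<open>B\<close>, \<open>C\<close> be the classes of vertices seeing only \<open>a\<close>, \<open>b\<close>,
  \<open>c\<close>. Saturation makes \<open>A\<close> complete to the class seeing exactly \<open>b\<close> and \<open>c\<close> (and symmetrically), and
  all remaining edges off \<open>v, a, b, c\<close> lie in the tripartite graph on \<open>A, B, C\<close>, in which any two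
  nonadjacent vertices of different parts have a common neighbour in the third part. Hence a vertex
  \<open>x \<in> A\<close> forces \<open>|B| + |C| - deg x\<close> edges between \<open>B\<close> and \<open>C\<close>: a vertex of \<open>B\<close> not adjacent to \<open>x\<close>
  sends an edge to the neighbours of \<open>x\<close> in \<open>C\<close>, and vice versa; two vertices of \<open>A\<close> without common
  neighbours in \<open>B\<close> and \<open>C\<close> force almost twice as many. This yields the bound 15, and equality
  only if every vertex outside \<open>N[v]\<close> sees one or all of \<open>a, b, c\<close> and some vertex of \<open>A\<close> (up to renaming) has just two
  neighbours in \<open>B \<union> C\<close>. In the twin-free case all neighbours of \<open>a\<close> then have degree 3, which makes
  the graph an instance of the \<open>s, x, y, z\<close> construction with some index set \<open>{1..n}\<close>; its weight is
  \<open>15 - (n - 3) (n - 4)\<close>. Deleting one of two twins of degree 3 preserves all hypotheses, since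
  in an extremal graph their common neighbours have degree at least 4.\<close>

section \<open>Counting edges\<close>

definition nb :: "('a \<Rightarrow> 'a \<Rightarrow> bool) \<Rightarrow> 'a \<Rightarrow> 'a set \<Rightarrow> nat" where
  "nb E x Y = card {y \<in> Y. E x y}"

text \<open>This counts ordered pairs: for a symmetric relation, \<open>ec E V V\<close> is twice the number of edges.\<close>

definition ec :: "('a \<Rightarrow> 'a \<Rightarrow> bool) \<Rightarrow> 'a set \<Rightarrow> 'a set \<Rightarrow> nat" where
  "ec E X Y = (\<Sum>x\<in>X. nb E x Y)"

lemma nb_eq_sum: "finite Y \<Longrightarrow> nb E x Y = (\<Sum>y\<in>Y. if E x y then 1 else 0)"
  by (simp add: nb_def flip: sum.inter_filter)

lemma nb_Un: "finite Y \<Longrightarrow> finite Z \<Longrightarrow> Y \<inter> Z = {} \<Longrightarrow> nb E x (Y \<union> Z) = nb E x Y + nb E x Z"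
  by (simp add: nb_eq_sum sum.union_disjoint)

lemma nb_mono: "finite Z \<Longrightarrow> Y \<subseteq> Z \<Longrightarrow> nb E x Y \<le> nb E x Z"
  unfolding nb_def by (rule card_mono) auto

lemma nb_pos: "finite Y \<Longrightarrow> y \<in> Y \<Longrightarrow> E x y \<Longrightarrow> 1 \<le> nb E x Y"
  unfolding nb_def by (simp add: Suc_le_eq card_gt_0_iff) blast

lemma nb_le_card: "finite Y \<Longrightarrow> nb E x Y \<le> card Y"
  unfolding nb_def by (rule card_mono) auto

lemma nb_all: "(\<And>y. y \<in> Y \<Longrightarrow> E x y) \<Longrightarrow> nb E x Y = card Y"
  unfolding nb_def by (rule arg_cong[where f = card]) auto

lemma nb_none: "(\<And>y. y \<in> Y \<Longrightarrow> \<not> E x y) \<Longrightarrow> nb E x Y = 0"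
  unfolding nb_def by (auto intro: card_eq_0_iff[THEN iffD2])

lemma ec_commute:
  assumes "finite X" "finite Y" "\<And>x y. E x y \<longleftrightarrow> E y x"
  shows "ec E X Y = ec E Y X"
proof -
  have "ec E X Y = (\<Sum>x\<in>X. \<Sum>y\<in>Y. if E x y then 1 else 0)"
    using assms by (simp add: ec_def nb_eq_sum)
  also have "\<dots> = (\<Sum>y\<in>Y. \<Sum>x\<in>X. if E x y then 1 else 0)" by (rule sum.swap)
  also have "\<dots> = (\<Sum>y\<in>Y. \<Sum>x\<in>X. if E y x then 1 else 0)" by (simp only: assms(3))
  also have "\<dots> = ec E Y X" using assms by (simp add: ec_def nb_eq_sum)
  finally show ?thesis .
qed

lemma ec_Un_left: "finite X \<Longrightarrow> finite X' \<Longrightarrow> X \<inter> X' = {} \<Longrightarrow> ec E (X \<union> X') Y = ec E X Y + ec E X' Y"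
  by (simp add: ec_def sum.union_disjoint)

lemma ec_Un_right: "finite Y \<Longrightarrow> finite Y' \<Longrightarrow> Y \<inter> Y' = {} \<Longrightarrow> ec E X (Y \<union> Y') = ec E X Y + ec E X Y'"
  by (simp add: ec_def nb_Un sum.distrib)

lemma ec_ge: "(\<And>x. x \<in> X \<Longrightarrow> k \<le> nb E x Y) \<Longrightarrow> k * card X \<le> ec E X Y"
  unfolding ec_def using sum_bounded_below[of X k "\<lambda>x. nb E x Y"] by (simp add: mult.commute)

lemma ec_eq: "(\<And>x. x \<in> X \<Longrightarrow> nb E x Y = k) \<Longrightarrow> ec E X Y = k * card X"
  by (simp add: ec_def)

lemma ec_mono: "finite X' \<Longrightarrow> finite Y' \<Longrightarrow> X \<subseteq> X' \<Longrightarrow> Y \<subseteq> Y' \<Longrightarrow> ec E X Y \<le> ec E X' Y'"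
  unfolding ec_def
  by (rule order_trans[OF sum_mono sum_mono2]) (auto intro: nb_mono)

section \<open>Saturated tripartite graphs\<close>

text \<open>Apart from symmetry, only pairs in different parts are constrained, so the adjacency of
  the whole graph can serve as \<open>E\<close> without being restricted to the three parts.\<close>

locale tripartite =
  fixes E :: "'a \<Rightarrow> 'a \<Rightarrow> bool" and A B C :: "'a set"
  assumes finA [simp]: "finite A" and finB [simp]: "finite B" and finC [simp]: "finite C"
    and sym: "E x y \<longleftrightarrow> E y x"
    and no_tri: "x \<in> A \<Longrightarrow> y \<in> B \<Longrightarrow> z \<in> C \<Longrightarrow> E x y \<Longrightarrow> E y z \<Longrightarrow> E x z \<Longrightarrow> False"
    and satAB: "x \<in> A \<Longrightarrow> y \<in> B \<Longrightarrow> \<not> E x y \<Longrightarrow> \<exists>z\<in>C. E x z \<and> E y z"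
    and satBC: "y \<in> B \<Longrightarrow> z \<in> C \<Longrightarrow> \<not> E y z \<Longrightarrow> \<exists>x\<in>A. E y x \<and> E z x"
    and satAC: "x \<in> A \<Longrightarrow> z \<in> C \<Longrightarrow> \<not> E x z \<Longrightarrow> \<exists>y\<in>B. E x y \<and> E z y"
begin

text \<open>Together with \<open>rot\<close> this generates all six orders of the parts. Most bounds
  below single out a vertex of \<open>A\<close> and reach \<open>B\<close> and \<open>C\<close> this
  way.\<close>

lemma swap: "tripartite E A C B"
  using sym no_tri satAB satBC satAC by unfold_locales (simp_all, (blast | metis)+)

lemma rot: "tripartite E B C A"
  using sym no_tri satAB satBC satAC by unfold_locales (simp_all, (blast | metis)+)

abbreviation twice_size :: nat where "twice_size \<equiv> 2 * card A + 2 * card B + 2 * card C"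
abbreviation edges :: nat where "edges \<equiv> ec E A B + ec E B C + ec E A C"

section \<open>Edges between two parts forced by one or two vertices of the third\<close>

lemma ec_sym: "finite X \<Longrightarrow> finite Y \<Longrightarrow> ec E X Y = ec E Y X"
  by (rule ec_commute) (auto simp: sym)

text \<open>Saturation gives every non-neighbour of \<open>x\<close> in \<open>B\<close> an edge to
  a neighbour of \<open>x\<close> in \<open>C\<close>, and vice versa. The two families of edges are
  disjoint: their ends in \<open>B\<close> lie outside and inside the neighbourhood of
  \<open>x\<close>, respectively.\<close>

lemma edges_ge_one:
  assumes x: "x \<in> A"
  shows "card B + card C \<le> ec E B C + nb E x B + nb E x C"
proof -
  define P where "P = {y \<in> B. E x y}"
  define R where "R = {z \<in> C. E x z}"
  have fin: "finite P" "finite R" by (auto simp: P_def R_def)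
  have sub: "P \<subseteq> B" "R \<subseteq> C" by (auto simp: P_def R_def)
  have "1 * card (B - P) \<le> ec E (B - P) R"
  proof (rule ec_ge)
    fix y assume "y \<in> B - P"
    then obtain z where "z \<in> C" "E x z" "E y z" using satAB[of x y] x by (auto simp: P_def)
    then show "1 \<le> nb E y R" using fin by (intro nb_pos[of _ z]) (auto simp: R_def)
  qed
  moreover have "1 * card (C - R) \<le> ec E (C - R) P"
  proof (rule ec_ge)
    fix y assume "y \<in> C - R"
    then obtain z where "z \<in> B" "E x z" "E y z" using satAC[of x y] x by (auto simp: R_def)
    then show "1 \<le> nb E y P" using fin by (intro nb_pos[of _ z]) (auto simp: P_def)
  qed
  moreover have "ec E (C - R) P = ec E P (C - R)" using fin by (intro ec_sym) auto
  moreover have "ec E B C = ec E P C + ec E (B - P) C"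
    using ec_Un_left[of P "B - P" E C] fin sub by (simp add: Un_absorb1)
  moreover have "ec E P (C - R) \<le> ec E P C" "ec E (B - P) R \<le> ec E (B - P) C"
    using fin sub by (auto intro!: ec_mono)
  moreover have "card (B - P) + card P = card B" "card (C - R) + card R = card C"
    using fin sub by (simp_all add: card_Diff_subset card_mono)
  moreover have "nb E x B = card P" "nb E x C = card R"
    by (simp_all add: nb_def P_def R_def)
  ultimately show ?thesis by linarith
qed

text \<open>As the neighbourhoods of \<open>x\<close> and \<open>x'\<close> are disjoint, a vertex
  of \<open>B\<close> or \<open>C\<close> adjacent to neither sends one edge into each of them. The
  two maxima count the edges between \<open>P\<close> and \<open>R'\<close> and between
  \<open>P'\<close> and \<open>R\<close>: every vertex on either side misses one of
  \<open>x\<close>, \<open>x'\<close> and is forced to have an edge across.\<close>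

lemma edges_ge_two:
  assumes x: "x \<in> A" "x' \<in> A"
    and disj: "\<And>w. w \<in> B \<union> C \<Longrightarrow> E x w \<Longrightarrow> E x' w \<Longrightarrow> False"
  shows "2 * card B + 2 * card C + max (nb E x B) (nb E x' C) + max (nb E x' B) (nb E x C)
    \<le> ec E B C + 2 * (nb E x B + nb E x' B + nb E x C + nb E x' C)"
proof -
  define P where "P = {y \<in> B. E x y}"
  define R where "R = {z \<in> C. E x z}"
  define P' where "P' = {y \<in> B. E x' y}"
  define R' where "R' = {z \<in> C. E x' z}"
  note defs = P_def R_def P'_def R'_def
  have fin: "finite P" "finite R" "finite P'" "finite R'" by (auto simp: defs)
  have sub: "P \<union> P' \<subseteq> B" "R \<union> R' \<subseteq> C" by (auto simp: defs)
  have dj: "P \<inter> P' = {}" "R \<inter> R' = {}" using disj by (auto simp: defs)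
  define m1 m2 where m1_def: "m1 = max (card P) (card R')" and m2_def: "m2 = max (card P') (card R)"
  have nbs: "1 \<le> nb E y R" if y: "y \<in> B - P" for y
  proof -
    obtain z where "z \<in> C" "E x z" "E y z" using y satAB[of x y] x unfolding P_def by blast
    then show ?thesis using fin by (intro nb_pos[of _ z]) (auto simp: R_def)
  qed
  have nbs': "1 \<le> nb E y R'" if y: "y \<in> B - P'" for y
  proof -
    obtain z where "z \<in> C" "E x' z" "E y z" using y satAB[of x' y] x unfolding P'_def by blast
    then show ?thesis using fin by (intro nb_pos[of _ z]) (auto simp: R'_def)
  qed
  have nbt: "1 \<le> nb E y P" if y: "y \<in> C - R" for y
  proof -
    obtain z where "z \<in> B" "E x z" "E y z" using y satAC[of x y] x unfolding R_def by blast
    then show ?thesis using fin by (intro nb_pos[of _ z]) (auto simp: P_def)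
  qed
  have nbt': "1 \<le> nb E y P'" if y: "y \<in> C - R'" for y
  proof -
    obtain z where "z \<in> B" "E x' z" "E y z" using y satAC[of x' y] x unfolding R'_def by blast
    then show ?thesis using fin by (intro nb_pos[of _ z]) (auto simp: P'_def)
  qed
  have b1: "2 * card (B - (P \<union> P')) \<le> ec E (B - (P \<union> P')) (R \<union> R')"
  proof (rule ec_ge)
    fix y assume "y \<in> B - (P \<union> P')"
    then show "2 \<le> nb E y (R \<union> R')" using nbs[of y] nbs'[of y] by (simp add: nb_Un fin dj)
  qed
  have b2: "2 * card (C - (R \<union> R')) \<le> ec E (C - (R \<union> R')) (P \<union> P')"
  proof (rule ec_ge)
    fix y assume "y \<in> C - (R \<union> R')"
    then show "2 \<le> nb E y (P \<union> P')" using nbt[of y] nbt'[of y] by (simp add: nb_Un fin dj)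
  qed
  have PsubB: "P \<subseteq> B - P'" "P' \<subseteq> B - P" "R \<subseteq> C - R'" "R' \<subseteq> C - R"
    using dj sub by auto
  have "1 * card P \<le> ec E P R'" "1 * card P' \<le> ec E P' R"
    "1 * card R' \<le> ec E R' P" "1 * card R \<le> ec E R P'"
    using PsubB by (blast intro: ec_ge nbs nbs' nbt nbt')+
  then have b3: "m1 \<le> ec E P R'" "m2 \<le> ec E P' R" unfolding m1_def m2_def
    using ec_sym[of P R'] ec_sym[of P' R] fin by auto
  have "ec E (P \<union> P') (R \<union> R') = ec E P R + ec E P R' + (ec E P' R + ec E P' R')"
    using fin dj by (simp add: ec_Un_left ec_Un_right)
  moreover have "ec E B C = ec E (P \<union> P') C + ec E (B - (P \<union> P')) C"
    using ec_Un_left[of "P \<union> P'" "B - (P \<union> P')" E C] fin sub by (simp add: Un_absorb1)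
  moreover have "ec E (P \<union> P') C = ec E (P \<union> P') (R \<union> R') + ec E (P \<union> P') (C - (R \<union> R'))"
    using ec_Un_right[of "R \<union> R'" "C - (R \<union> R')" E] fin sub by (simp add: Un_absorb1)
  moreover have "ec E (B - (P \<union> P')) (R \<union> R') \<le> ec E (B - (P \<union> P')) C"
    using fin sub by (auto intro!: ec_mono)
  moreover have "ec E (P \<union> P') (C - (R \<union> R')) = ec E (C - (R \<union> R')) (P \<union> P')"
    using fin by (intro ec_sym) auto
  moreover have "card (B - (P \<union> P')) + (card P + card P') = card B"
    "card (C - (R \<union> R')) + (card R + card R') = card C"
    using fin sub dj card_Un_disjoint[of P P'] card_Un_disjoint[of R R']
      card_mono[OF finB sub(1)] card_mono[OF finC sub(2)]
    by (simp_all add: card_Diff_subset)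
  ultimately have "2 * card B + 2 * card C + m1 + m2
      \<le> ec E B C + 2 * (card P + card P' + card R + card R')"
    using b1 b2 b3 by (simp add: algebra_simps)
  then show ?thesis by (simp add: m1_def m2_def nb_def defs)
qed

section \<open>Vertices of \<open>A\<close> with exactly one neighbour in \<open>B\<close> and one
  in \<open>C\<close>\<close>

lemma degree_two_twin:
  assumes x: "x \<in> A" "{w \<in> B. E x w} = {y}" "{w \<in> C. E x w} = {z}"
    and x': "x' \<in> A" "E x' y \<or> E x' z"
    and mixed: "\<exists>w\<in>B. E x' w" "\<exists>w\<in>C. E x' w"
  shows "{w \<in> B. E x' w} = {y} \<and> {w \<in> C. E x' w} = {z}"
proof -
  have yz: "y \<in> B" "E x y" "z \<in> C" "E x z" using x by blast+
  have uy: "w = y" if "w \<in> B" "E x w" for w using that x(2) by blast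
  have uz: "w = z" if "w \<in> C" "E x w" for w using that x(3) by blast
  \<comment> \<open>Since \<open>y\<close> and \<open>z\<close> are the only neighbours of
    \<open>x\<close> in \<open>B\<close> and \<open>C\<close>, saturation joins \<open>z\<close> to
    all of \<open>B\<close> other than \<open>y\<close>, and \<open>y\<close> to all of
    \<open>C\<close> other than \<open>z\<close>. Any further neighbour of \<open>x'\<close> then
    closes a triangle.\<close>
  have zB: "E w z" if "w \<in> B" "w \<noteq> y" for w
    using satAB[OF x(1) that(1)] uy uz that by blast
  have yC: "E w y" if "w \<in> C" "w \<noteq> z" for w
    using satAC[OF x(1) that(1)] uy uz that by blast
  have B': "w = y" if "E x' z" "w \<in> B" "E x' w" for w
    using no_tri[OF x'(1) that(2) yz(3) that(3)] zB[OF that(2)] that(1) by blast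
  have C': "w = z" if "E x' y" "w \<in> C" "E x' w" for w
    using no_tri[OF x'(1) yz(1) that(2,1)] yC[OF that(2)] that(3) sym[of y w] by blast
  obtain y' z' where "y' \<in> B" "E x' y'" "z' \<in> C" "E x' z'" using mixed by blast
  then have "E x' y \<and> E x' z" using x'(2) B' C' by blast
  then show ?thesis using B' C' yz by blast
qed

text \<open>By \<open>edges_ge_two\<close> the edges between \<open>B\<close> and \<open>C\<close>
  number at least \<open>2 * card B + 2 * card C - 4\<close> minus the degree of \<open>x'\<close>
  into \<open>B\<close> and \<open>C\<close>. The edges at \<open>x'\<close> make up for that
  degree, and each other vertex of \<open>A\<close> adds at least 2. The set \<open>X\<close>
  records a surplus: the empty set gives the plain bound, a singleton excludes degree 3 in the case
  of equality.\<close>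

lemma degree_two_edges:
  assumes x: "x \<in> A" "{w \<in> B. E x w} = {y}" "{w \<in> C. E x w} = {z}"
    and x': "x' \<in> A" "\<not> E x' y" "\<not> E x' z"
    and mixed: "\<And>x. x \<in> A \<Longrightarrow> \<exists>w\<in>B. E x w" "\<And>x. x \<in> A \<Longrightarrow> \<exists>w\<in>C. E x w"
    and X: "X \<subseteq> A - {x'}" "\<And>w. w \<in> X \<Longrightarrow> 3 \<le> nb E w B + nb E w C"
  shows "twice_size + card X \<le> edges + 6"
proof -
  have pos: "1 \<le> nb E w B" "1 \<le> nb E w C" if "w \<in> A" for w
    using mixed[OF that] nb_pos[OF finB] nb_pos[OF finC] by blast+
  have deg2: "2 \<le> nb E w B + nb E w C" if "w \<in> A" for w
    using pos[OF that] by simp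
  have nx: "nb E x B = 1" "nb E x C = 1" using x by (auto simp: nb_def)
  have "2 * card B + 2 * card C + max 1 (nb E x' C) + max (nb E x' B) 1
    \<le> ec E B C + 2 * (1 + nb E x' B + 1 + nb E x' C)"
  proof -
    have "\<And>w. w \<in> B \<union> C \<Longrightarrow> E x w \<Longrightarrow> E x' w \<Longrightarrow> False"
      using x(2,3) x'(2,3) by (metis (mono_tags, lifting) Un_iff mem_Collect_eq singletonD)
    then show ?thesis using edges_ge_two[OF x(1) x'(1)] unfolding nx by blast
  qed
  \<comment> \<open>As \<open>x'\<close> has neighbours in both parts, the two maxima are
    \<open>nb E x' C\<close> and \<open>nb E x' B\<close>.\<close>
  then have bc: "2 * card B + 2 * card C \<le> ec E B C + nb E x' B + nb E x' C + 4"
    using pos[OF x'(1)] by simp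
  have finX: "finite X" using X(1) finite_subset by fastforce
  have "ec E A B + ec E A C = (\<Sum>w\<in>A. nb E w B + nb E w C)"
    by (simp add: ec_def sum.distrib)
  also have "\<dots> = (nb E x' B + nb E x' C) + (\<Sum>w\<in>A - {x'}. nb E w B + nb E w C)"
    by (rule sum.remove[OF finA x'(1)])
  also have "(\<Sum>w\<in>A - {x'}. nb E w B + nb E w C)
      = (\<Sum>w\<in>X. nb E w B + nb E w C) + (\<Sum>w\<in>A - {x'} - X. nb E w B + nb E w C)"
    using sum.subset_diff[OF X(1)] by (simp add: add.commute)
  finally have *: "ec E A B + ec E A C = (nb E x' B + nb E x' C)
      + ((\<Sum>w\<in>X. nb E w B + nb E w C) + (\<Sum>w\<in>A - {x'} - X. nb E w B + nb E w C))" .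
  have S1: "card X * 3 \<le> (\<Sum>w\<in>X. nb E w B + nb E w C)"
    using sum_bounded_below[of X 3 "\<lambda>w. nb E w B + nb E w C"] X(2) by simp
  have S2: "card (A - {x'} - X) * 2 \<le> (\<Sum>w\<in>A - {x'} - X. nb E w B + nb E w C)"
    using sum_bounded_below[of "A - {x'} - X" 2 "\<lambda>w. nb E w B + nb E w C"] deg2 by simp
  have "card X \<le> card (A - {x'})" using X(1) by (simp add: card_mono)
  moreover have "card (A - {x'}) + 1 = card A" using x'(1) card.remove[of A x'] by simp
  ultimately have cA: "card (A - {x'} - X) + card X + 1 = card A"
    using card_Diff_subset[OF finX X(1)] by linarith
  show ?thesis
    using * S1 S2 cA bc
    by (simp add: algebra_simps)
qed


lemma edges_two_commute: "2 * ec E A B + 2 * ec E B C + 2 * ec E A C =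
    ec E A B + ec E A C + (ec E B A + ec E B C) + (ec E C A + ec E C B)"
  using ec_sym[of A B] ec_sym[of A C] ec_sym[of B C] by simp

text \<open>Either some vertex of \<open>A\<close> misses both \<open>y\<close> and
  \<open>z\<close>, and \<open>degree_two_edges\<close> applies, or \<open>degree_two_twin\<close>
  applies to every vertex of \<open>A\<close>.\<close>

lemma edges_ge_min_degree_two:
  assumes mixed: "\<And>x. x \<in> A \<Longrightarrow> \<exists>w\<in>B. E x w" "\<And>x. x \<in> A \<Longrightarrow> \<exists>w\<in>C. E x w"
    and x: "x \<in> A" "{w \<in> B. E x w} = {y}" "{w \<in> C. E x w} = {z}"
  shows "twice_size \<le> edges + 6 \<or> (\<forall>x'\<in>A. {w \<in> B. E x' w} = {y} \<and> {w \<in> C. E x' w} = {z})"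
proof (cases "\<exists>x'\<in>A. \<not> E x' y \<and> \<not> E x' z")
  case True
  then obtain x' where x': "x' \<in> A" "\<not> E x' y" "\<not> E x' z" by blast
  have "twice_size + card ({} :: 'a set) \<le> edges + 6"
    by (rule degree_two_edges[OF x x' mixed]) simp_all
  then show ?thesis by simp
next
  case False
  have "{w \<in> B. E x' w} = {y} \<and> {w \<in> C. E x' w} = {z}" if "x' \<in> A" for x'
  proof (rule degree_two_twin[OF x that])
    show "E x' y \<or> E x' z" using False that by blast
  qed (use mixed that in blast)+
  then show ?thesis by blast
qed

text \<open>A charging argument: \<open>y\<close> and the vertices of \<open>Z\<close> pass each of
  their edges to its other end, which counts it on top of its own degree. Vertices of
  \<open>B - {y}\<close> and \<open>C - Z\<close> then count at least 4, because saturation forces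
  an edge into \<open>Z\<close> or to \<open>y\<close>. Those of \<open>A - {x}\<close> do so by
  \<open>good\<close>, and \<open>x\<close> counts 6. With n vertices in all, the total of at least
  4n - 10 is at most twice the number of edges.\<close>

lemma edges_ge_degree_three_base:
  assumes x: "x \<in> A" "{w \<in> B. E x w} = {y}" "{w \<in> C. E x w} = Z" "card Z = 2"
    and degB: "\<And>w. w \<in> B \<Longrightarrow> 3 \<le> nb E w A + nb E w C"
    and degC: "\<And>w. w \<in> C \<Longrightarrow> 3 \<le> nb E w A + nb E w B"
    and good: "\<And>w. w \<in> A - {x} \<Longrightarrow> 4 \<le> nb E w B + nb E w C + nb E w {y} + nb E w Z"
  shows "twice_size \<le> edges + 5"
proof -
  have ux: "w \<in> B \<and> E x w \<longleftrightarrow> w = y" for w using x(2) unfolding set_eq_iff by simp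
  have uZ: "w \<in> C \<and> E x w \<longleftrightarrow> w \<in> Z" for w using x(3) unfolding set_eq_iff by simp
  have Z: "Z \<subseteq> C" "finite Z" using uZ x(4) by (blast, simp add: card_ge_0_finite)
  have y: "y \<in> B" "E x y" using ux by blast+
  have "nb E x {y} = card {y}" "nb E x Z = card Z" using y(2) uZ by (blast intro: nb_all)+
  then have nx: "nb E x B = 1" "nb E x C = 2" "nb E x {y} = 1" "nb E x Z = 2"
    using x(4) by (simp_all add: nb_def x(2,3))
  have yC: "1 * card (C - Z) \<le> ec E (C - Z) {y}"
  proof (rule ec_ge)
    fix w assume w: "w \<in> C - Z"
    then obtain u where "u \<in> B" "E x u" "E w u" using satAC[OF x(1), of w] uZ by blast
    then show "1 \<le> nb E w {y}" using ux[of u] by (intro nb_pos[of _ y]) auto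
  qed
  have ZB: "1 * card (B - {y}) \<le> ec E (B - {y}) Z"
  proof (rule ec_ge)
    fix w assume w: "w \<in> B - {y}"
    then obtain u where "u \<in> C" "E x u" "E w u" using satAB[OF x(1), of w] ux by blast
    then show "1 \<le> nb E w Z" using Z uZ[of u] by (intro nb_pos[of _ u]) auto
  qed
  have split: "ec E B A = ec E {y} A + ec E (B - {y}) A" "ec E B C = ec E {y} C + ec E (B - {y}) C"
    "ec E C A = ec E Z A + ec E (C - Z) A" "ec E C B = ec E Z B + ec E (C - Z) B"
    using ec_Un_left[of "{y}" "B - {y}" E] ec_Un_left[of Z "C - Z" E] Z y(1)
    by (simp_all add: Un_absorb1 insert_absorb)
  have comm: "ec E {y} A = ec E A {y}" "ec E {y} C = ec E C {y}" "ec E Z A = ec E A Z" "ec E Z B = ec E B Z"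
    using Z by (auto intro: ec_sym)
  have mono: "ec E (C - Z) {y} \<le> ec E C {y}" "ec E (B - {y}) Z \<le> ec E B Z"
    using Z by (auto intro!: ec_mono)
  have sB: "3 * card (B - {y}) \<le> ec E (B - {y}) A + ec E (B - {y}) C"
    using sum_bounded_below[of "B - {y}" 3 "\<lambda>w. nb E w A + nb E w C"] degB
    by (simp add: ec_def sum.distrib)
  have sC: "3 * card (C - Z) \<le> ec E (C - Z) A + ec E (C - Z) B"
    using sum_bounded_below[of "C - Z" 3 "\<lambda>w. nb E w A + nb E w B"] degC
    by (simp add: ec_def sum.distrib)
  have "4 * card (A - {x}) \<le> (\<Sum>w\<in>A - {x}. nb E w B + nb E w C + nb E w {y} + nb E w Z)"
    using sum_bounded_below[of "A - {x}" 4 "\<lambda>w. nb E w B + nb E w C + nb E w {y} + nb E w Z"] good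
    by simp
  moreover have "ec E A B + ec E A C + ec E A {y} + ec E A Z
      = 6 + (\<Sum>w\<in>A - {x}. nb E w B + nb E w C + nb E w {y} + nb E w Z)"
    unfolding ec_def sum.distrib[symmetric] using x(1) nx
    by (subst sum.remove[OF finA x(1)]) simp
  ultimately have sA: "6 + 4 * card (A - {x}) \<le> ec E A B + ec E A C + ec E A {y} + ec E A Z" by simp
  have cards: "card (A - {x}) + 1 = card A" "card (B - {y}) + 1 = card B" "card (C - Z) + 2 = card C"
    using x(1) y Z x(4) card.remove[of A x] card.remove[of B y] card_mono[OF finC Z(1)]
    by (simp_all add: card_Diff_subset)
  show ?thesis
    using edges_two_commute split comm mono sB sC sA yC ZB cards by linarith
qed

lemma edges_ge_degree_three_one_two:
  assumes mixed: "\<And>x. x \<in> A \<Longrightarrow> \<exists>w\<in>B. E x w" "\<And>x. x \<in> A \<Longrightarrow> \<exists>w\<in>C. E x w"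
      "\<And>x. x \<in> B \<Longrightarrow> \<exists>w\<in>A. E x w" "\<And>x. x \<in> C \<Longrightarrow> \<exists>w\<in>A. E x w"
    and degA: "\<And>w. w \<in> A \<Longrightarrow> 3 \<le> nb E w B + nb E w C"
    and degB: "\<And>w. w \<in> B \<Longrightarrow> 3 \<le> nb E w A + nb E w C"
    and degC: "\<And>w. w \<in> C \<Longrightarrow> 3 \<le> nb E w A + nb E w B"
    and x: "x \<in> A" "nb E x B = 1" "nb E x C = 2"
  shows "twice_size \<le> edges + 5"
proof (rule ccontr)
  assume neg: "\<not> ?thesis"
  have sA: "3 * card A \<le> ec E A B + ec E A C"
    using sum_bounded_below[of A 3 "\<lambda>w. nb E w B + nb E w C"] degA by (simp add: ec_def sum.distrib)
  have sB: "3 * card B \<le> ec E B A + ec E B C"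
    using sum_bounded_below[of B 3 "\<lambda>w. nb E w A + nb E w C"] degB by (simp add: ec_def sum.distrib)
  have sC: "3 * card C \<le> ec E C A + ec E C B"
    using sum_bounded_below[of C 3 "\<lambda>w. nb E w A + nb E w B"] degC by (simp add: ec_def sum.distrib)
  \<comment> \<open>With n vertices and e edges, minimum degree 3 gives 3n \<le> 2e, whereas a
    counterexample has e \<le> 2n - 6.\<close>
  have size: "12 \<le> card A + card B + card C" using sA sB sC neg edges_two_commute by linarith
  obtain y where y: "{w \<in> B. E x w} = {y}" using x(2) by (auto simp: nb_def card_1_singleton_iff)
  have uy: "w \<in> B \<and> E x w \<longleftrightarrow> w = y" for w using y unfolding set_eq_iff by simp
  define Z where "Z = {w \<in> C. E x w}"
  have Z: "card Z = 2" "finite Z" using x(3) by (auto simp: nb_def Z_def)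
  \<comment> \<open>If every other vertex of \<open>A\<close> met the bound, the charging argument
    would already finish the proof. A vertex failing it has degree exactly 3 and shares no neighbour
    with \<open>x\<close> in \<open>B\<close> and \<open>C\<close>.\<close>
  have "\<exists>x'\<in>A - {x}. \<not> 4 \<le> nb E x' B + nb E x' C + nb E x' {y} + nb E x' Z"
  proof (rule ccontr)
    assume "\<not> ?thesis"
    then have "\<And>w. w \<in> A - {x} \<Longrightarrow> 4 \<le> nb E w B + nb E w C + nb E w {y} + nb E w Z" by blast
    from edges_ge_degree_three_base[OF x(1) y Z_def[symmetric] Z(1) degB degC this] neg
    show False by simp
  qed
  then obtain x' where "x' \<in> A - {x}" "\<not> 4 \<le> nb E x' B + nb E x' C + nb E x' {y} + nb E x' Z"
    by blast
  then have x': "x' \<in> A" "x' \<noteq> x" "nb E x' B + nb E x' C + nb E x' {y} + nb E x' Z < 4" by simp_all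
  have d3: "nb E x' B + nb E x' C = 3" and "nb E x' {y} = 0" "nb E x' Z = 0"
    using degA[OF x'(1)] x'(3) by linarith+
  then have nadj: "\<not> E x' y" "\<And>w. w \<in> Z \<Longrightarrow> \<not> E x' w" using Z(2) by (auto simp: nb_def)
  have "1 \<le> nb E x' B" "1 \<le> nb E x' C"
    using mixed(1,2)[OF x'(1)] nb_pos[OF finB] nb_pos[OF finC] by blast+
  then have types: "nb E x' B = 1 \<and> nb E x' C = 2 \<or> nb E x' B = 2 \<and> nb E x' C = 1"
    using d3 by linarith
  have disj: False if "w \<in> B \<union> C" "E x w" "E x' w" for w
    using that uy[of w] nadj by (auto simp: Z_def)
  have two: "2 * card B + 2 * card C + max (nb E x B) (nb E x' C) + max (nb E x' B) (nb E x C)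
    \<le> ec E B C + 2 * (nb E x B + nb E x' B + nb E x C + nb E x' C)"
    by (rule edges_ge_two[OF x(1) x'(1)]) (rule disj)
  \<comment> \<open>The constant is 12 - 3: the two degrees add up to 6 and enter doubled, and the
    two maxima add up to at least 3.\<close>
  have bc: "2 * card B + 2 * card C \<le> ec E B C + 9"
    using types two x(2,3) by auto
  have nA: "1 * card B \<le> ec E B A" "1 * card C \<le> ec E C A"
    using mixed(3,4) nb_pos[OF finA] by (blast intro: ec_ge)+
  have comm: "ec E B A = ec E A B" "ec E C A = ec E A C" "ec E C B = ec E B C" by (auto intro: ec_sym)
  have "card A \<le> 3" using bc sA neg by linarith
  have "card {x, x'} \<le> card A" using x(1) x'(1) by (intro card_mono) auto
  then have "2 \<le> card A" using x'(2) by simp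
  have sum2: "ec E A B + ec E A C = 6 + (\<Sum>w\<in>A - {x} - {x'}. nb E w B + nb E w C)"
  proof -
    have "ec E A B + ec E A C = (\<Sum>w\<in>A. nb E w B + nb E w C)" by (simp add: ec_def sum.distrib)
    also have "\<dots> = 3 + (\<Sum>w\<in>A - {x}. nb E w B + nb E w C)"
      using x by (subst sum.remove[OF finA x(1)]) simp
    also have "(\<Sum>w\<in>A - {x}. nb E w B + nb E w C) = 3 + (\<Sum>w\<in>A - {x} - {x'}. nb E w B + nb E w C)"
      using x' d3 by (subst sum.remove[of "A - {x}" x']) auto
    finally show ?thesis by simp
  qed
  show False
  proof (cases "card A = 2")
    case True
    then have "card (A - {x} - {x'}) = 0" using x(1) x' by (simp add: card_Diff_subset)
    then have "A - {x} - {x'} = {}" by simp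
    \<comment> \<open>Every vertex of \<open>B\<close> and \<open>C\<close> has a neighbour in
      \<open>A\<close>, so six edges allow at most six such vertices, against
      \<open>size\<close>.\<close>
    then have "ec E A B + ec E A C = 6" using sum2 by (simp only: sum.empty)
    then show False using nA comm size True by linarith
  next
    case False
    then have cA: "card A = 3" using \<open>card A \<le> 3\<close> \<open>2 \<le> card A\<close> by simp
    have tot: "ec E A B + ec E B C + ec E A C + 5 < 6 + 2 * card B + 2 * card C" using neg cA by simp
    then have "card B + card C = 9" using bc nA comm size cA by linarith
    \<comment> \<open>All estimates are now equalities, and parity decides: \<open>ec E B C\<close>
      would be both 9 and twice \<open>card B\<close>.\<close>
    then have "ec E A B = card B" "ec E A C = card C" "ec E B C = 2 * card B" "ec E B C = 9"
      using tot bc nA comm sA sB sC cA by linarith+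
    then show False by presburger
  qed
qed

text \<open>A vertex of degree 3 splits it as 1 + 2 over the other two parts, which is the previous
  lemma after one of six renamings. Without such a vertex all degrees are at least 4, and double
  counting gives more than is claimed.\<close>

lemma edges_ge_min_degree_three:
  assumes mixed: "\<And>x. x \<in> A \<Longrightarrow> (\<exists>w\<in>B. E x w) \<and> (\<exists>w\<in>C. E x w)"
      "\<And>x. x \<in> B \<Longrightarrow> (\<exists>w\<in>A. E x w) \<and> (\<exists>w\<in>C. E x w)"
      "\<And>x. x \<in> C \<Longrightarrow> (\<exists>w\<in>A. E x w) \<and> (\<exists>w\<in>B. E x w)"
    and degA: "\<And>w. w \<in> A \<Longrightarrow> 3 \<le> nb E w B + nb E w C"
    and degB: "\<And>w. w \<in> B \<Longrightarrow> 3 \<le> nb E w A + nb E w C"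
    and degC: "\<And>w. w \<in> C \<Longrightarrow> 3 \<le> nb E w A + nb E w B"
  shows "twice_size \<le> edges + 5"
proof -
  interpret ACB: tripartite E A C B by (rule swap)
  interpret BCA: tripartite E B C A by (rule rot)
  interpret BAC: tripartite E B A C by (rule BCA.swap)
  interpret CAB: tripartite E C A B by (rule BCA.rot)
  interpret CBA: tripartite E C B A by (rule CAB.swap)
  have degs: "\<And>w. w \<in> A \<Longrightarrow> 3 \<le> nb E w C + nb E w B" "\<And>w. w \<in> B \<Longrightarrow> 3 \<le> nb E w C + nb E w A"
    "\<And>w. w \<in> C \<Longrightarrow> 3 \<le> nb E w B + nb E w A"
    using degA degB degC by (simp_all add: add.commute)
  have comm: "ec E B A = ec E A B" "ec E C A = ec E A C" "ec E C B = ec E B C" by (auto intro: ec_sym)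
  consider (A) x where "x \<in> A" "nb E x B + nb E x C = 3" | (B) x where "x \<in> B" "nb E x A + nb E x C = 3"
    | (C) x where "x \<in> C" "nb E x A + nb E x B = 3"
    | (none) "\<forall>x\<in>A. nb E x B + nb E x C \<noteq> 3" "\<forall>x\<in>B. nb E x A + nb E x C \<noteq> 3"
        "\<forall>x\<in>C. nb E x A + nb E x B \<noteq> 3"
    by blast
  then show ?thesis
  proof cases
    case A
    then have "1 \<le> nb E x B" "1 \<le> nb E x C" using mixed(1) nb_pos[OF finB] nb_pos[OF finC] by blast+
    then consider "nb E x B = 1" "nb E x C = 2" | "nb E x C = 1" "nb E x B = 2" using A by linarith
    then show ?thesis
      using edges_ge_degree_three_one_two[of x] ACB.edges_ge_degree_three_one_two[of x] A mixed degA degB degC degs comm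
      by cases simp_all
  next
    case B
    then have "1 \<le> nb E x A" "1 \<le> nb E x C" using mixed(2) nb_pos[OF finA] nb_pos[OF finC] by blast+
    then consider "nb E x A = 1" "nb E x C = 2" | "nb E x C = 1" "nb E x A = 2" using B by linarith
    then show ?thesis
      using BAC.edges_ge_degree_three_one_two[of x] BCA.edges_ge_degree_three_one_two[of x] B mixed degA degB degC degs comm
      by cases simp_all
  next
    case C
    then have "1 \<le> nb E x A" "1 \<le> nb E x B" using mixed(3) nb_pos[OF finA] nb_pos[OF finB] by blast+
    then consider "nb E x A = 1" "nb E x B = 2" | "nb E x B = 1" "nb E x A = 2" using C by linarith
    then show ?thesis
      using CAB.edges_ge_degree_three_one_two[of x] CBA.edges_ge_degree_three_one_two[of x] C mixed degA degB degC degs comm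
      by cases simp_all
  next
    case none
    have four: "\<And>x. x \<in> A \<Longrightarrow> 4 \<le> nb E x B + nb E x C" "\<And>x. x \<in> B \<Longrightarrow> 4 \<le> nb E x A + nb E x C"
        "\<And>x. x \<in> C \<Longrightarrow> 4 \<le> nb E x A + nb E x B"
      using none degA degB degC by (force simp: le_less)+
    have "4 * card A \<le> ec E A B + ec E A C"
      using sum_bounded_below[of A 4 "\<lambda>w. nb E w B + nb E w C"] four(1) by (simp add: ec_def sum.distrib)
    moreover have "4 * card B \<le> ec E B A + ec E B C"
      using sum_bounded_below[of B 4 "\<lambda>w. nb E w A + nb E w C"] four(2) by (simp add: ec_def sum.distrib)
    moreover have "4 * card C \<le> ec E C A + ec E C B"
      using sum_bounded_below[of C 4 "\<lambda>w. nb E w A + nb E w B"] four(3) by (simp add: ec_def sum.distrib)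
    ultimately show ?thesis using edges_two_commute by linarith
  qed
qed


section \<open>Bounds for parts whose vertices have neighbours in both other parts\<close>

lemma edges_ge_remove:
  assumes x: "x \<in> A" and k: "\<And>w. w \<in> A \<Longrightarrow> w \<noteq> x \<Longrightarrow> k \<le> nb E w B + nb E w C"
  shows "card B + card C + k * card (A - {x}) \<le> edges"
proof -
  have "k * card (A - {x}) \<le> (\<Sum>w\<in>A - {x}. nb E w B + nb E w C)"
    using sum_bounded_below[of "A - {x}" k "\<lambda>w. nb E w B + nb E w C"] k by (simp add: mult.commute)
  moreover have "ec E A B + ec E A C = nb E x B + nb E x C + (\<Sum>w\<in>A - {x}. nb E w B + nb E w C)"
    unfolding ec_def sum.distrib[symmetric] by (rule sum.remove[OF finA x])
  ultimately show ?thesis using edges_ge_one[OF x] by linarith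
qed

lemma degree_two_singletons:
  assumes "x \<in> A" "nb E x B + nb E x C = 2" "\<exists>w\<in>B. E x w" "\<exists>w\<in>C. E x w"
  obtains y z where "{w \<in> B. E x w} = {y}" "{w \<in> C. E x w} = {z}"
proof -
  have "1 \<le> nb E x B" "1 \<le> nb E x C" using assms nb_pos[OF finB] nb_pos[OF finC] by blast+
  then have "nb E x B = 1" "nb E x C = 1" using assms(2) by linarith+
  then show ?thesis using that by (auto simp: nb_def card_1_singleton_iff)
qed

lemma degree_ge_two:
  assumes "\<exists>w\<in>B. E x w" "\<exists>w\<in>C. E x w"
  shows "2 \<le> nb E x B + nb E x C"
proof -
  have "1 \<le> nb E x B" "1 \<le> nb E x C" using assms nb_pos[OF finB] nb_pos[OF finC] by blast+
  then show ?thesis by linarith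
qed

text \<open>Made for a base vertex with exactly one nonempty cell seeing two of its neighbours.
  There \<open>C\<close> is the cell complete to that one and gets coefficient 1 only, because those
  edges are counted separately. If all degrees in \<open>A\<close> are at least 3, the surplus
  \<open>card A\<close> pays for the second \<open>card B\<close>.\<close>

lemma edges_ge_mixed_pair:
  assumes mixed: "\<And>x. x \<in> A \<Longrightarrow> \<exists>w\<in>B. E x w" "\<And>x. x \<in> A \<Longrightarrow> \<exists>w\<in>C. E x w"
      "\<And>x. x \<in> B \<Longrightarrow> \<exists>w\<in>A. E x w"
    and "A \<noteq> {}" "card B \<le> card A" "2 \<le> card C"
  shows "2 * card A + 2 * card B + card C \<le> edges + 4"
proof (cases "\<exists>x\<in>A. nb E x B + nb E x C = 2")
  case True
  then obtain x where x: "x \<in> A" "nb E x B + nb E x C = 2" by blast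
  obtain y z where yz: "{w \<in> B. E x w} = {y}" "{w \<in> C. E x w} = {z}"
    by (rule degree_two_singletons[OF x mixed(1)[OF x(1)] mixed(2)[OF x(1)]])
  from edges_ge_min_degree_two[OF mixed(1,2) x(1) yz] show ?thesis
  proof
    assume twins: "\<forall>x'\<in>A. {w \<in> B. E x' w} = {y} \<and> {w \<in> C. E x' w} = {z}"
    have "B \<subseteq> {y}"
    proof
      fix w assume w: "w \<in> B"
      then obtain u where u: "u \<in> A" "E w u" using mixed(3) by blast
      then have "w \<in> {w \<in> B. E u w}" using w sym by blast
      then show "w \<in> {y}" using twins u(1) by simp
    qed
    then have "card B \<le> 1" using card_mono[of "{y}" B] by simp
    moreover have "nb E w B = 1" "nb E w C = 1" if "w \<in> A" for w
      using twins that by (simp_all add: nb_def)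
    then have "ec E A B = 1 * card A" "ec E A C = 1 * card A" by (blast intro: ec_eq)+
    ultimately show ?thesis using edges_ge_one[OF x(1)] x(2) by linarith
  next
    assume "twice_size \<le> edges + 6"
    with \<open>2 \<le> card C\<close> show ?thesis by linarith
  qed
next
  case False
  obtain x where x: "x \<in> A" using \<open>A \<noteq> {}\<close> by blast
  have "3 \<le> nb E w B + nb E w C" if "w \<in> A" for w
    using degree_ge_two[OF mixed(1)[OF that] mixed(2)[OF that]] False that by fastforce
  then have "card B + card C + 3 * card (A - {x}) \<le> edges" by (intro edges_ge_remove[OF x])
  moreover have "card (A - {x}) + 1 = card A" using x card.remove[of A x] by simp
  ultimately show ?thesis using \<open>card B \<le> card A\<close> by linarith
qed

text \<open>If no vertex of \<open>A\<close> misses both \<open>y\<close> and \<open>z\<close>, then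
  all are twins relative to \<open>B\<close> and \<open>C\<close>, these parts shrink to at most one
  vertex each, and the inequality is strict. Equality therefore leaves the pair \<open>x\<close>,
  \<open>x'\<close> from which the structure is later derived.\<close>

lemma edges_ge_mixed_degree_two:
  assumes mixed: "\<And>x. x \<in> A \<Longrightarrow> (\<exists>w\<in>B. E x w) \<and> (\<exists>w\<in>C. E x w)"
      "\<And>x. x \<in> B \<Longrightarrow> (\<exists>w\<in>A. E x w) \<and> (\<exists>w\<in>C. E x w)"
      "\<And>x. x \<in> C \<Longrightarrow> (\<exists>w\<in>A. E x w) \<and> (\<exists>w\<in>B. E x w)"
    and x: "x \<in> A" "nb E x B + nb E x C = 2"
  shows "twice_size < edges + 6 \<or>
    (twice_size = edges + 6 \<and> (\<exists>x\<in>A. \<exists>x'\<in>A. \<exists>y z. {w \<in> B. E x w} = {y} \<and> {w \<in> C. E x w} = {z} \<and> \<not> E x' y \<and> \<not> E x' z))"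
proof -
  have mixed': "\<And>x. x \<in> A \<Longrightarrow> \<exists>w\<in>B. E x w" "\<And>x. x \<in> A \<Longrightarrow> \<exists>w\<in>C. E x w" using mixed(1) by blast+
  obtain y z where yz: "{w \<in> B. E x w} = {y}" "{w \<in> C. E x w} = {z}"
    by (rule degree_two_singletons[OF x mixed'(1)[OF x(1)] mixed'(2)[OF x(1)]])
  show ?thesis
  proof (cases "\<exists>x'\<in>A. \<not> E x' y \<and> \<not> E x' z")
    case True
    then obtain x' where x': "x' \<in> A" "\<not> E x' y" "\<not> E x' z" by blast
    have "twice_size + card ({} :: 'a set) \<le> edges + 6"
      by (rule degree_two_edges[OF x(1) yz x' mixed']) simp_all
    then show ?thesis using x(1) yz x' by (simp add: le_less) blast
  next
    case False
    have twins: "{w \<in> B. E x' w} = {y} \<and> {w \<in> C. E x' w} = {z}" if "x' \<in> A" for x'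
    proof (rule degree_two_twin[OF x(1) yz that])
      show "E x' y \<or> E x' z" using False that by blast
    qed (use mixed' that in blast)+
    have "B \<subseteq> {y}"
    proof
      fix w assume w: "w \<in> B"
      then obtain u where u: "u \<in> A" "E w u" using mixed(2) by blast
      then have "w \<in> {w \<in> B. E u w}" using w sym by blast
      then show "w \<in> {y}" using twins u(1) by simp
    qed
    moreover have "C \<subseteq> {z}"
    proof
      fix w assume w: "w \<in> C"
      then obtain u where u: "u \<in> A" "E w u" using mixed(3) by blast
      then have "w \<in> {w \<in> C. E u w}" using w sym by blast
      then show "w \<in> {z}" using twins u(1) by simp
    qed
    ultimately have "card B \<le> 1" "card C \<le> 1"
      using card_mono[of "{y}" B] card_mono[of "{z}" C] by simp_all
    moreover have "nb E w B = 1" "nb E w C = 1" if "w \<in> A" for w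
      using twins[OF that] by (simp_all add: nb_def)
    then have "ec E A B = 1 * card A" "ec E A C = 1 * card A" by (blast intro: ec_eq)+
    ultimately show ?thesis by simp
  qed
qed

end

section \<open>The cells of a vertex of degree 3\<close>

text \<open>A missing edge creates a triangle exactly if its ends have a common neighbour;
  \<open>K3_saturated_iff\<close> makes the link. Working with a predicate \<open>E\<close> makes it
  easy to restrict the graph when a vertex is deleted.\<close>

locale saturated =
  fixes V :: "'a set" and E :: "'a \<Rightarrow> 'a \<Rightarrow> bool"
  assumes finV [simp]: "finite V"
    and Esym: "E u v \<longleftrightarrow> E v u"
    and Edom: "E u v \<Longrightarrow> u \<in> V"
    and triangle: "E u v \<Longrightarrow> E v w \<Longrightarrow> E u w \<Longrightarrow> False"
    and common: "u \<in> V \<Longrightarrow> v \<in> V \<Longrightarrow> u \<noteq> v \<Longrightarrow> \<not> E u v \<Longrightarrow> \<exists>w. E u w \<and> E v w"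
begin

lemma symD: "E u v \<Longrightarrow> E v u"
  using Esym by blast

lemma irrefl: "\<not> E u u"
  using triangle by blast

text \<open>The vertex \<open>v\<close> itself would fall into the cell of its whole neighbourhood
  and has to be excluded. Indexing by sets makes the cells independent of the order in which the
  neighbours are named.\<close>

definition cell :: "'a \<Rightarrow> 'a set \<Rightarrow> 'a set" where
  "cell v S = {w \<in> V. w \<noteq> v \<and> (\<forall>u. E v u \<longrightarrow> (E u w \<longleftrightarrow> u \<in> S))}"

lemma finite_cell [simp]: "finite (cell v S)"
  by (simp add: cell_def)

end

locale cubic_vertex = saturated +
  fixes v a b c :: 'a
  assumes vV: "v \<in> V" and nbs: "E v u \<longleftrightarrow> u = a \<or> u = b \<or> u = c"
    and distinct: "a \<noteq> b" "a \<noteq> c" "b \<noteq> c"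
begin

abbreviation "A \<equiv> cell v {a}"
abbreviation "B \<equiv> cell v {b}"
abbreviation "C \<equiv> cell v {c}"
abbreviation "AB \<equiv> cell v {a, b}"
abbreviation "AC \<equiv> cell v {a, c}"
abbreviation "BC \<equiv> cell v {b, c}"
abbreviation "ABC \<equiv> cell v {a, b, c}"

lemma mem_cell: "w \<in> cell v S \<longleftrightarrow>
    w \<in> V \<and> w \<noteq> v \<and> (E a w \<longleftrightarrow> a \<in> S) \<and> (E b w \<longleftrightarrow> b \<in> S) \<and> (E c w \<longleftrightarrow> c \<in> S)"
  unfolding cell_def nbs by auto

lemma abcV: "a \<in> V" "b \<in> V" "c \<in> V"
  using nbs symD Edom by blast+

lemma abc_nonadj: "\<not> E a b" "\<not> E a c" "\<not> E b c" "\<not> E b a" "\<not> E c a" "\<not> E c b"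
  using nbs triangle symD by blast+

lemma v_adj: "E v a" "E v b" "E v c" "E a v" "E b v" "E c v"
  using nbs symD by blast+

text \<open>Facts about cells are proved for one cell of each kind and transferred by interpreting
  the locale with renamed neighbours.\<close>

lemma perm_acb: "cubic_vertex V E v a c b"
  by unfold_locales (use vV nbs distinct in auto)

lemma perm_bca: "cubic_vertex V E v b c a"
  by unfold_locales (use vV nbs distinct in auto)

text \<open>By saturation a vertex not adjacent to \<open>v\<close> shares a neighbour with it, so
  it sees at least one of \<open>a\<close>, \<open>b\<close>, \<open>c\<close>.\<close>

lemma V_cases:
  assumes "w \<in> V"
  shows "w = v \<or> w = a \<or> w = b \<or> w = c \<or> w \<in> A \<or> w \<in> B \<or> w \<in> C \<or> w \<in> AB \<or> w \<in> AC \<or> w \<in> BC \<or> w \<in> ABC"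
proof (cases "w = v \<or> E v w")
  case False
  then obtain u where u: "E v u" "E w u" using common[of v w] vV assms by blast
  then have "E a w \<or> E b w \<or> E c w" using nbs[of u] symD[OF u(2)] by auto
  then show ?thesis using False assms distinct unfolding mem_cell by simp blast
qed (use nbs in auto)

lemma nonadj_cells:
  assumes "x \<in> cell v S" "y \<in> cell v T" "u \<in> S" "u \<in> T" "u = a \<or> u = b \<or> u = c"
  shows "\<not> E x y"
  using assms triangle symD unfolding mem_cell by blast

text \<open>Saturation for the non-adjacent pair \<open>b\<close>, \<open>x\<close> yields a common
  neighbour. It misses \<open>a\<close>, since \<open>x\<close> sees \<open>a\<close>, so only its
  adjacency to \<open>c\<close> remains open.\<close>

lemma nb_A_obtain_B:
  assumes x: "x \<in> A"
  shows "\<exists>w\<in>B \<union> BC. E x w"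
proof -
  have "\<not> E b x" "b \<noteq> x" "x \<in> V" "E a x" "\<not> E v x" "x \<noteq> v"
    using x distinct abc_nonadj v_adj triangle unfolding mem_cell by auto
  then obtain w where w: "E b w" "E x w" using common[of b x] abcV by blast
  have "w \<in> V" "w \<noteq> v" using w \<open>\<not> E v x\<close> Edom symD by blast+
  moreover have "\<not> E a w" using w \<open>E a x\<close> triangle symD by blast
  ultimately show ?thesis using w unfolding mem_cell Un_iff Bex_def using distinct by auto
qed

lemma nb_BC_obtain_A:
  assumes x: "x \<in> BC"
  shows "\<exists>w\<in>A. E x w"
proof -
  have "\<not> E a x" "a \<noteq> x" "x \<in> V" "E b x" "E c x" "\<not> E v x" "x \<noteq> v"
    using x distinct abc_nonadj v_adj triangle unfolding mem_cell by auto
  then obtain w where w: "E a w" "E x w" using common[of a x] abcV by blast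
  have "w \<in> V" "w \<noteq> v" using w \<open>\<not> E v x\<close> Edom symD by blast+
  moreover have "\<not> E b w" "\<not> E c w" using w \<open>E b x\<close> \<open>E c x\<close> triangle symD by blast+
  ultimately show ?thesis using w unfolding mem_cell Bex_def using distinct by auto
qed

text \<open>A common neighbour of \<open>x\<close> and \<open>u\<close> would see none of
  \<open>a\<close>, \<open>b\<close>, \<open>c\<close>. It could only be one of \<open>v\<close>,
  \<open>a\<close>, \<open>b\<close>, \<open>c\<close>, and none of these is adjacent to
  both.\<close>

lemma adj_A_BC:
  assumes x: "x \<in> A" and u: "u \<in> BC"
  shows "E x u"
proof (rule ccontr)
  assume "\<not> E x u"
  moreover have x': "E a x" "\<not> E b x" "\<not> E c x" "x \<in> V" and u': "E b u" "E c u" "\<not> E a u" "u \<in> V"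
    using x u distinct unfolding mem_cell by auto
  ultimately obtain w where w: "E x w" "E u w" using common[of x u] by blast
  then have "w \<in> V" using Edom symD by blast
  moreover have "\<not> E a w" "\<not> E b w" "\<not> E c w" using w x' u' triangle symD by blast+
  ultimately have "w = v \<or> w = a \<or> w = b \<or> w = c" using V_cases[of w] unfolding mem_cell by auto
  moreover have "\<not> E x v" using x' triangle v_adj symD by blast
  ultimately show False using w x' u' symD by blast
qed

text \<open>A common neighbour of \<open>x\<close> and \<open>y\<close> misses \<open>a\<close> and
  \<open>b\<close>, so it lies in \<open>C\<close>. Hence the cells \<open>A\<close>,
  \<open>B\<close>, \<open>C\<close> form a saturated tripartite graph on their own.\<close>

lemma satAB:
  assumes x: "x \<in> A" and y: "y \<in> B" and "\<not> E x y"
  shows "\<exists>z\<in>C. E x z \<and> E y z"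
proof -
  have x': "E a x" "\<not> E b x" "\<not> E c x" "x \<in> V" and y': "E b y" "\<not> E c y" "\<not> E a y" "y \<in> V"
    using x y distinct unfolding mem_cell by auto
  then obtain w where w: "E x w" "E y w" using common[of x y] \<open>\<not> E x y\<close> by blast
  then have "w \<in> V" using Edom symD by blast
  moreover have "\<not> E a w" "\<not> E b w" using w x' y' triangle symD by blast+
  moreover have "\<not> E x v" using x' triangle v_adj symD by blast
  moreover have "w \<noteq> a" "w \<noteq> b" "w \<noteq> c" using w x' y' symD by blast+
  ultimately have "w \<in> C" using V_cases[of w] w(1) unfolding mem_cell by auto
  then show ?thesis using w by blast
qed

lemma nb_A:
  assumes w: "w \<in> A"
  shows "nb E w V = 1 + nb E w B + nb E w C + card BC"
proof -
  have "u = a \<or> u \<in> B \<or> u \<in> C \<or> u \<in> BC" if "E w u" for u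
  proof -
    have "u \<in> V" using that Edom symD by blast
    moreover have "\<not> E a u" "u \<noteq> v" "u \<noteq> b" "u \<noteq> c"
      using that w v_adj triangle symD distinct unfolding mem_cell by blast+
    ultimately show ?thesis using V_cases[of u] unfolding mem_cell by auto
  qed
  then have "nb E w V = nb E w ({a} \<union> (B \<union> (C \<union> BC)))"
    unfolding nb_def using abcV by (intro arg_cong[where f = card]) (auto simp: mem_cell)
  also have "\<dots> = nb E w {a} + (nb E w B + (nb E w C + nb E w BC))"
    using abc_nonadj irrefl distinct by (subst nb_Un; (auto simp: mem_cell)?)+
  also have "nb E w {a} = card {a}" using w symD by (intro nb_all) (auto simp: mem_cell)
  also have "nb E w BC = card BC" using adj_A_BC[OF w] by (rule nb_all)
  finally show ?thesis by simp
qed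

lemma nb_BC:
  assumes w: "w \<in> BC"
  shows "nb E w V = 2 + card A"
proof -
  have "u = b \<or> u = c \<or> u \<in> A" if "E w u" for u
  proof -
    have "u \<in> V" using that Edom symD by blast
    moreover have "\<not> E b u" "\<not> E c u" "u \<noteq> v" "u \<noteq> a"
      using that w v_adj triangle symD distinct unfolding mem_cell by blast+
    ultimately show ?thesis using V_cases[of u] unfolding mem_cell by auto
  qed
  then have "nb E w V = nb E w ({b, c} \<union> A)"
    unfolding nb_def using abcV by (intro arg_cong[where f = card]) (auto simp: mem_cell)
  also have "\<dots> = nb E w {b, c} + nb E w A"
    using abc_nonadj by (intro nb_Un) (auto simp: mem_cell)
  also have "nb E w {b, c} = card {b, c}" using w symD distinct by (intro nb_all) (auto simp: mem_cell)
  also have "nb E w A = card A" using adj_A_BC[OF _ w] symD by (intro nb_all) blast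
  finally show ?thesis using distinct by simp
qed

text \<open>These vertices are twins of \<open>v\<close>; each adds one vertex and three edges and
  leaves the weight unchanged.\<close>

lemma nb_ABC:
  assumes w: "w \<in> ABC"
  shows "{u. E w u} = {a, b, c}"
proof -
  have "u = a \<or> u = b \<or> u = c" if "E w u" for u
  proof -
    have "u \<in> V" using that Edom symD by blast
    moreover have "\<not> E a u" "\<not> E b u" "\<not> E c u" "u \<noteq> v"
      using that w v_adj triangle symD distinct unfolding mem_cell by blast+
    ultimately show ?thesis using V_cases[of u] unfolding mem_cell by auto
  qed
  then show ?thesis using w symD by (auto simp: mem_cell)
qed

lemma nb_a: "nb E a V = 1 + card A + card AB + card AC + card ABC"
proof -
  have "{u \<in> V. E a u} = {v} \<union> (A \<union> (AB \<union> (AC \<union> ABC)))"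
    using V_cases v_adj vV abc_nonadj irrefl distinct by (auto simp: mem_cell) 
  moreover have "card ({v} \<union> (A \<union> (AB \<union> (AC \<union> ABC)))) = 1 + (card A + (card AB + (card AC + card ABC)))"
    using distinct by (subst card_Un_disjoint; (auto simp: mem_cell)?)+
  ultimately show ?thesis by (simp add: nb_def)
qed

end

section \<open>Renamings of the three neighbours, and sums over the cells\<close>

context cubic_vertex
begin

lemma perm_bac: "cubic_vertex V E v b a c"
  by unfold_locales (use vV nbs distinct in auto)

lemma perm_cab: "cubic_vertex V E v c a b"
  by unfold_locales (use vV nbs distinct in auto)

lemma perm_cba: "cubic_vertex V E v c b a"
  by unfold_locales (use vV nbs distinct in auto)

lemma tripartite_cells: "tripartite E A B C"
proof -
  interpret bca: cubic_vertex V E v b c a by (rule perm_bca)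
  interpret acb: cubic_vertex V E v a c b by (rule perm_acb)
  show ?thesis
  proof unfold_locales
    show "False" if "E x y" "E y z" "E x z" for x y z
      using triangle that by blast
    show "\<exists>z\<in>C. E x z \<and> E y z" if "x \<in> A" "y \<in> B" "\<not> E x y" for x y
      using satAB that by blast
    show "\<exists>x\<in>A. E y x \<and> E z x" if "y \<in> B" "z \<in> C" "\<not> E y z" for y z
      using bca.satAB that by blast
    show "\<exists>y\<in>B. E x y \<and> E z y" if "x \<in> A" "z \<in> C" "\<not> E x z" for x z
      using acb.satAB that by blast
  qed (simp_all add: Esym)
qed

end

sublocale cubic_vertex \<subseteq> tri: tripartite E A B C
  by (rule tripartite_cells)

context cubic_vertex
begin

lemma V_eq: "V = insert v (insert a (insert b (insert c (A \<union> (B \<union> (C \<union> (AB \<union> (AC \<union> (BC \<union> ABC)))))))))"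
proof (intro equalityI subsetI)
  fix w assume "w \<in> V"
  then show "w \<in> insert v (insert a (insert b (insert c (A \<union> (B \<union> (C \<union> (AB \<union> (AC \<union> (BC \<union> ABC)))))))))"
    using V_cases[of w] by blast
qed (use vV abcV in \<open>auto simp: mem_cell\<close>)

lemma cells_disjoint:
    "A \<inter> B = {}" "A \<inter> C = {}" "A \<inter> AB = {}" "A \<inter> AC = {}" "A \<inter> BC = {}" "A \<inter> ABC = {}" "B \<inter> C = {}" "B \<inter> AB = {}" "B \<inter> AC = {}" "B \<inter> BC = {}" "B \<inter> ABC = {}" "C \<inter> AB = {}"
    "C \<inter> AC = {}" "C \<inter> BC = {}" "C \<inter> ABC = {}" "AB \<inter> AC = {}" "AB \<inter> BC = {}" "AB \<inter> ABC = {}" "AC \<inter> BC = {}" "AC \<inter> ABC = {}" "BC \<inter> ABC = {}"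
  using distinct by (simp_all add: disjoint_iff mem_cell)

lemma not_in_cell: "S \<noteq> {} \<Longrightarrow> S \<subseteq> {a, b, c} \<Longrightarrow> v \<notin> cell v S \<and> a \<notin> cell v S \<and> b \<notin> cell v S \<and> c \<notin> cell v S"
  using abc_nonadj irrefl by (auto simp: mem_cell)

lemma sum_V:
  "(\<Sum>w\<in>V. f w) = f v + (f a + (f b + (f c + (sum f A + (sum f B + (sum f C
    + (sum f AB + (sum f AC + (sum f BC + sum f ABC)))))))))"
proof -
  have ne: "v \<noteq> a" "v \<noteq> b" "v \<noteq> c" using v_adj irrefl by blast+
  define U where "U = A \<union> (B \<union> (C \<union> (AB \<union> (AC \<union> (BC \<union> ABC)))))"
  have "sum f U = sum f A + (sum f B + (sum f C + (sum f AB + (sum f AC + (sum f BC + sum f ABC)))))"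
    unfolding U_def by (simp add: sum.union_disjoint Int_Un_distrib cells_disjoint)
  moreover have "v \<notin> U" "a \<notin> U" "b \<notin> U" "c \<notin> U" unfolding U_def by (simp_all add: not_in_cell)
  moreover have "V = insert v (insert a (insert b (insert c U)))" "finite U"
    unfolding U_def by (rule V_eq) simp
  ultimately show ?thesis using ne distinct by simp
qed

lemma card_V: "card V = 4 + card A + card B + card C + card AB + card AC + card BC + card ABC"
  using sum_V[of "\<lambda>_. 1 :: nat"] by simp

text \<open>Compared with 6 times \<open>card_V\<close>, the contribution of \<open>ABC\<close>
  cancels, and \<open>6 * card V < ec E V V + 30\<close> becomes:
  \<open>tri.twice_size + card AB + card AC + card BC\<close> is less than
  \<open>tri.edges + 6\<close> plus the three products. The bounds below prove this
  inequality.\<close>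

lemma degree_sum:
  "ec E V V = 6 + 2 * card A + 2 * card B + 2 * card C + 4 * card AB + 4 * card AC + 4 * card BC
    + 6 * card ABC + 2 * ec E A B + 2 * ec E B C + 2 * ec E A C
    + 2 * (card A * card BC) + 2 * (card B * card AC) + 2 * (card C * card AB)"
proof -
  interpret bac: cubic_vertex V E v b a c by (rule perm_bac)
  interpret cab: cubic_vertex V E v c a b by (rule perm_cab)
  have "{w \<in> V. E v w} = {a, b, c}" using nbs abcV by auto
  then have v: "nb E v V = 3" using distinct by (simp add: nb_def)
  have ABC: "nb E w V = 3" if "w \<in> ABC" for w
  proof -
    have "{u \<in> V. E w u} = {a, b, c}" using nb_ABC[OF that] abcV by auto
    then show ?thesis using distinct by (simp add: nb_def)
  qed
  have "sum (\<lambda>w. nb E w V) A = card A + ec E A B + ec E A C + card A * card BC"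
    by (simp add: nb_A ec_def sum.distrib sum_Suc)
  moreover have "sum (\<lambda>w. nb E w V) B = card B + ec E B A + ec E B C + card B * card AC"
    by (simp add: bac.nb_A ec_def sum.distrib sum_Suc)
  moreover have "sum (\<lambda>w. nb E w V) C = card C + ec E C A + ec E C B + card C * card AB"
    by (simp add: cab.nb_A ec_def sum.distrib sum_Suc)
  moreover have "sum (\<lambda>w. nb E w V) BC = 2 * card BC + card A * card BC"
    by (simp add: nb_BC sum_Suc algebra_simps)
  moreover have "sum (\<lambda>w. nb E w V) AC = 2 * card AC + card B * card AC"
    by (simp add: bac.nb_BC sum_Suc algebra_simps)
  moreover have "sum (\<lambda>w. nb E w V) AB = 2 * card AB + card C * card AB"
    by (simp add: cab.nb_BC sum_Suc algebra_simps)
  moreover have "sum (\<lambda>w. nb E w V) ABC = 3 * card ABC"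
    using ABC by simp
  moreover have "nb E b V = 1 + card B + card AB + card BC + card ABC"
    using bac.nb_a by (simp add: insert_commute)
  moreover have "nb E c V = 1 + card C + card AC + card BC + card ABC"
    using cab.nb_a by (simp add: insert_commute)
  moreover have "ec E B A = ec E A B" "ec E C A = ec E A C" "ec E C B = ec E B C"
    by (auto intro: tri.ec_sym)
  ultimately show ?thesis
    using v nb_a unfolding ec_def[of E V V] sum_V[of "\<lambda>w. nb E w V"] by linarith
qed

section \<open>The strict bound when some vertex sees exactly two of the three neighbours\<close>

lemma BC_empty_if_A_empty: "A = {} \<Longrightarrow> BC = {}"
  using nb_BC_obtain_A by blast

lemma mult_ge_add: "1 \<le> x \<Longrightarrow> 1 \<le> y \<Longrightarrow> x + y \<le> x * y + (1 :: nat)"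
  by (cases x; cases y) auto

text \<open>Each product in \<open>degree_sum\<close> is at least the sum of its factors minus 1, so
  \<open>card A + card B + card C - 1\<close> edges between the three cells are more than
  enough.\<close>

lemma bound_all:
  assumes "BC \<noteq> {}" "AC \<noteq> {}" "AB \<noteq> {}"
  shows "6 * card V < ec E V V + 30"
proof -
  interpret bac: cubic_vertex V E v b a c by (rule perm_bac)
  interpret cab: cubic_vertex V E v c a b by (rule perm_cab)
  have ne: "A \<noteq> {}" "B \<noteq> {}" "C \<noteq> {}"
    using assms BC_empty_if_A_empty bac.BC_empty_if_A_empty cab.BC_empty_if_A_empty by auto
  then have "1 \<le> card A" "1 \<le> card B" "1 \<le> card C" "1 \<le> card BC" "1 \<le> card AC" "1 \<le> card AB"
    using assms by (simp_all add: Suc_le_eq card_gt_0_iff)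
  note ge = mult_ge_add[OF this(1,4)] mult_ge_add[OF this(2,5)] mult_ge_add[OF this(3,6)]
  obtain x where x: "x \<in> A" using ne by blast
  obtain y where y: "y \<in> B" using ne by blast
  have "1 \<le> nb E w B + nb E w C" if w: "w \<in> A" for w
  proof (cases "E w y")
    case True
    then have "1 \<le> nb E w B" using y by (intro nb_pos) auto
    then show ?thesis by simp
  next
    case False
    then obtain z where "z \<in> C" "E w z" using satAB[OF w y] by blast
    then have "1 \<le> nb E w C" by (intro nb_pos) auto
    then show ?thesis by simp
  qed
  then have "card B + card C + 1 * card (A - {x}) \<le> tri.edges" by (intro tri.edges_ge_remove[OF x])
  moreover have "card (A - {x}) + 1 = card A" using x card.remove[of A x] by simp
  ultimately show ?thesis using degree_sum card_V ge by linarith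
qed

lemma mixed_if_empty:
  assumes "BC = {}" shows "x \<in> A \<Longrightarrow> \<exists>w\<in>B. E x w" "x \<in> A \<Longrightarrow> \<exists>w\<in>C. E x w"
proof -
  interpret acb: cubic_vertex V E v a c b by (rule perm_acb)
  show "x \<in> A \<Longrightarrow> \<exists>w\<in>B. E x w" using nb_A_obtain_B assms by blast
  show "x \<in> A \<Longrightarrow> \<exists>w\<in>C. E x w" using acb.nb_A_obtain_B assms by (simp add: insert_commute)
qed

text \<open>As \<open>AB\<close> is empty, each vertex of \<open>C\<close> has neighbours in both
  \<open>A\<close> and \<open>B\<close> and contributes 2. If \<open>C\<close> is empty, saturation
  makes \<open>A\<close> complete to \<open>B\<close>, and the product of their sizes does the
  work.\<close>

lemma bound_two:
  assumes "BC \<noteq> {}" "AC \<noteq> {}" "AB = {}"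
  shows "6 * card V < ec E V V + 30"
proof -
  interpret bac: cubic_vertex V E v b a c by (rule perm_bac)
  interpret cab: cubic_vertex V E v c a b by (rule perm_cab)
  have ne: "A \<noteq> {}" "B \<noteq> {}"
    using assms BC_empty_if_A_empty bac.BC_empty_if_A_empty by auto
  then have one: "1 \<le> card A" "1 \<le> card B" "1 \<le> card BC" "1 \<le> card AC"
    using assms by (simp_all add: Suc_le_eq card_gt_0_iff)
  note ge = mult_ge_add[OF one(1,3)] mult_ge_add[OF one(2,4)] mult_ge_add[OF one(1,2)]
  have AB: "card AB = 0" using assms by simp
  show ?thesis
  proof (cases "C = {}")
    case True
    then have "nb E x B = card B" if "x \<in> A" for x
      using satAB[OF that] by (intro nb_all) auto
    then have "ec E A B = card B * card A" by (rule ec_eq)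
    then have "ec E A B = card A * card B" by (simp add: mult.commute)
    moreover have "card C = 0" using True by simp
    ultimately show ?thesis using degree_sum card_V ge AB by linarith
  next
    case False
    then obtain z where z: "z \<in> C" by blast
    have "card A + card B + 2 * card (C - {z}) \<le> cab.tri.edges"
    proof (rule cab.tri.edges_ge_remove[OF z])
      fix w assume "w \<in> C"
      then show "2 \<le> nb E w A + nb E w B"
        using cab.mixed_if_empty[of w] assms(3) by (intro cab.tri.degree_ge_two) auto
    qed
    moreover have "card (C - {z}) + 1 = card C" using z card.remove[of C z] by simp
    moreover have "ec E C A = ec E A C" "ec E C B = ec E B C" by (auto intro: tri.ec_sym)
    ultimately show ?thesis using degree_sum card_V ge AB by linarith
  qed
qed

lemma bound_one:
  assumes min3: "\<And>w. w \<in> V \<Longrightarrow> 3 \<le> nb E w V"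
    and "BC \<noteq> {}" "AC = {}" "AB = {}"
  shows "6 * card V < ec E V V + 30"
proof -
  interpret bac: cubic_vertex V E v b a c by (rule perm_bac)
  interpret cab: cubic_vertex V E v c a b by (rule perm_cab)
  interpret cba: cubic_vertex V E v c b a by (rule perm_cba)
  interpret bca: cubic_vertex V E v b c a by (rule perm_bca)
  have ne: "A \<noteq> {}" using assms BC_empty_if_A_empty by auto
  then have one: "1 \<le> card A" "1 \<le> card BC"
    using assms by (simp_all add: Suc_le_eq card_gt_0_iff)
  have zero: "card AB = 0" "card AC = 0" using assms by simp_all
  have mB: "\<exists>w\<in>A. E x w" "\<exists>w\<in>C. E x w" if "x \<in> B" for x
    using bac.mixed_if_empty[of x] assms that by auto
  have mC: "\<exists>w\<in>A. E x w" "\<exists>w\<in>B. E x w" if "x \<in> C" for x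
    using cab.mixed_if_empty[of x] assms that by auto
  have comm: "ec E B A = ec E A B" "ec E C A = ec E A C" "ec E C B = ec E B C"
    by (auto intro: tri.ec_sym)
  show ?thesis
  proof (cases "B = {}")
    case True
    then have C: "C = {}" using mC by blast
    obtain x where x: "x \<in> A" using ne by blast
    have "x \<in> V" using x by (simp add: mem_cell)
    \<comment> \<open>With \<open>B\<close> and \<open>C\<close> empty, a vertex of \<open>A\<close>
      sees only \<open>a\<close> and \<open>BC\<close>, so minimum degree 3 bounds \<open>BC\<close>
      from below.\<close>
    then have "2 \<le> card BC" using min3[of x] nb_A[OF x] True C by (simp add: nb_def)
    then obtain d where d: "card BC = 2 + d" using le_Suc_ex by blast
    have "card A * card BC = 2 * card A + card A * d" unfolding d by (simp add: algebra_simps)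
    moreover have "1 * d \<le> card A * d" using one(1) by (rule mult_right_mono) simp
    moreover have "card B = 0" "card C = 0" using True C by simp_all
    ultimately show ?thesis using degree_sum card_V zero d by linarith
  next
    case False
    then obtain y where y: "y \<in> B" by blast
    then have "C \<noteq> {}" using mB by blast
    \<comment> \<open>A single vertex in \<open>A\<close> would be adjacent to all of
      \<open>B\<close> and \<open>C\<close> and form a triangle with an edge between them.\<close>
    have "2 \<le> card A"
    proof (rule ccontr)
      assume "\<not> 2 \<le> card A"
      then have "card A = 1" using one by linarith
      then obtain x where A: "A = {x}" using card_1_singletonE by blast
      obtain z where "z \<in> C" "E y z" using mB[OF y] by blast
      moreover have "E y x" using mB(1)[OF y] A by simp
      moreover have "E z x" using mC(1)[OF \<open>z \<in> C\<close>] A by simp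
      ultimately show False using triangle by blast
    qed
    moreover note ge = mult_ge_add[OF one]
    moreover have "2 * card B + 2 * card C + card A \<le> tri.edges + 4"
    proof (cases "card C \<le> card B")
      case True
      have "2 * card B + 2 * card C + card A \<le> bca.tri.edges + 4"
        by (rule bca.tri.edges_ge_mixed_pair) (use mB mC True False \<open>2 \<le> card A\<close> in auto)
      then show ?thesis using comm by linarith
    next
      case le: False
      have "2 * card C + 2 * card B + card A \<le> cba.tri.edges + 4"
        by (rule cba.tri.edges_ge_mixed_pair) (use mB mC le \<open>C \<noteq> {}\<close> \<open>2 \<le> card A\<close> in auto)
      then show ?thesis using comm by linarith
    qed
    ultimately show ?thesis using degree_sum card_V zero by linarith
  qed
qed

end

section \<open>The case of equality\<close>

context cubic_vertex
begin

text \<open>The witnesses are those left by equality in \<open>edges_ge_mixed_degree_two\<close>.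
  The vertex with one neighbour in each other part is placed in \<open>A\<close>, so the notion
  depends on the naming of \<open>a\<close>, \<open>b\<close>, \<open>c\<close>.\<close>

definition tight :: bool where
  "tight \<longleftrightarrow> AB = {} \<and> AC = {} \<and> BC = {} \<and> 6 * card V = ec E V V + 30 \<and>
    (\<exists>x\<in>A. \<exists>x'\<in>A. \<exists>y z. {w \<in> B. E x w} = {y} \<and> {w \<in> C. E x w} = {z} \<and> \<not> E x' y \<and> \<not> E x' z)"

lemma mixed_cells:
  assumes "AB = {}" "AC = {}" "BC = {}"
  shows "x \<in> A \<Longrightarrow> (\<exists>w\<in>B. E x w) \<and> (\<exists>w\<in>C. E x w)"
    and "x \<in> B \<Longrightarrow> (\<exists>w\<in>A. E x w) \<and> (\<exists>w\<in>C. E x w)"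
    and "x \<in> C \<Longrightarrow> (\<exists>w\<in>A. E x w) \<and> (\<exists>w\<in>B. E x w)"
proof -
  interpret bac: cubic_vertex V E v b a c by (rule perm_bac)
  interpret cab: cubic_vertex V E v c a b by (rule perm_cab)
  show "x \<in> A \<Longrightarrow> (\<exists>w\<in>B. E x w) \<and> (\<exists>w\<in>C. E x w)" using mixed_if_empty assms by blast
  show "x \<in> B \<Longrightarrow> (\<exists>w\<in>A. E x w) \<and> (\<exists>w\<in>C. E x w)" using bac.mixed_if_empty assms by blast
  show "x \<in> C \<Longrightarrow> (\<exists>w\<in>A. E x w) \<and> (\<exists>w\<in>B. E x w)" using cab.mixed_if_empty assms by blast
qed

lemma bound_degree_two:
  assumes empty: "AB = {}" "AC = {}" "BC = {}" and x: "x \<in> A" "nb E x B + nb E x C = 2"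
  shows "6 * card V < ec E V V + 30 \<or> tight"
proof -
  have zero: "card AB = 0" "card AC = 0" "card BC = 0" using empty by simp_all
  have *: "tri.twice_size < tri.edges + 6 \<longleftrightarrow> 6 * card V < ec E V V + 30"
    "tri.twice_size = tri.edges + 6 \<longleftrightarrow> 6 * card V = ec E V V + 30"
    using degree_sum card_V zero by auto
  show ?thesis
    using tri.edges_ge_mixed_degree_two[OF mixed_cells[OF empty] x] empty
    unfolding * tight_def by blast
qed

text \<open>Without a vertex of degree two in the tripartite graph,
  \<open>edges_ge_min_degree_three\<close> gives the strict inequality. Otherwise the existential
  quantifier renames the cell of such a vertex to \<open>A\<close>.\<close>

lemma bound_none:
  assumes empty: "AB = {}" "AC = {}" "BC = {}"
  shows "6 * card V < ec E V V + 30 \<or> (\<exists>a b c. cubic_vertex V E v a b c \<and> cubic_vertex.tight V E v a b c)"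
proof -
  interpret bac: cubic_vertex V E v b a c by (rule perm_bac)
  interpret cab: cubic_vertex V E v c a b by (rule perm_cab)
  have e: "cell v {b, a} = {}" "cell v {c, a} = {}" "cell v {c, b} = {}"
    using empty by (simp_all add: insert_commute)
  have zero: "card AB = 0" "card AC = 0" "card BC = 0" using empty by simp_all
  note mixed = mixed_cells[OF empty]
  consider (A) x where "x \<in> A" "nb E x B + nb E x C = 2" | (B) x where "x \<in> B" "nb E x A + nb E x C = 2"
    | (C) x where "x \<in> C" "nb E x A + nb E x B = 2"
    | (none) "\<forall>x\<in>A. nb E x B + nb E x C \<noteq> 2" "\<forall>x\<in>B. nb E x A + nb E x C \<noteq> 2"
        "\<forall>x\<in>C. nb E x A + nb E x B \<noteq> 2"
    by blast
  then show ?thesis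
  proof cases
    case A
    then show ?thesis using bound_degree_two[OF empty] cubic_vertex_axioms by blast
  next
    case B
    then show ?thesis using bac.bound_degree_two[OF e(1) empty(3,2)] bac.cubic_vertex_axioms by blast
  next
    case C
    then show ?thesis using cab.bound_degree_two[OF e(2,3) empty(1)] cab.cubic_vertex_axioms by blast
  next
    case none
    have "tri.twice_size \<le> tri.edges + 5"
    proof (rule tri.edges_ge_min_degree_three)
      show "3 \<le> nb E w B + nb E w C" if w: "w \<in> A" for w
        using tri.degree_ge_two[of w] mixed(1)[OF w] none(1) w by (force simp: le_less)
      show "3 \<le> nb E w A + nb E w C" if w: "w \<in> B" for w
        using bac.tri.degree_ge_two[of w] mixed(2)[OF w] none(2) w by (force simp: le_less)
      show "3 \<le> nb E w A + nb E w B" if w: "w \<in> C" for w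
        using cab.tri.degree_ge_two[of w] mixed(3)[OF w] none(3) w by (force simp: le_less)
    qed (use mixed in blast)+
    then show ?thesis using degree_sum card_V zero by linarith
  qed
qed

text \<open>Up to renaming only the number of nonempty cells among \<open>AB\<close>,
  \<open>AC\<close>, \<open>BC\<close> matters, and equality can survive only if there are
  none.\<close>

lemma bound:
  assumes min3: "\<And>w. w \<in> V \<Longrightarrow> 3 \<le> nb E w V"
  shows "6 * card V < ec E V V + 30 \<or> (\<exists>a b c. cubic_vertex V E v a b c \<and> cubic_vertex.tight V E v a b c)"
proof -
  interpret acb: cubic_vertex V E v a c b by (rule perm_acb)
  interpret bac: cubic_vertex V E v b a c by (rule perm_bac)
  interpret bca: cubic_vertex V E v b c a by (rule perm_bca)
  interpret cab: cubic_vertex V E v c a b by (rule perm_cab)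
  have e: "cell v {b, a} = AB" "cell v {c, a} = AC" "cell v {c, b} = BC"
    by (simp_all add: insert_commute)
  consider "AB = {}" "AC = {}" "BC = {}" | "BC \<noteq> {}" "AC \<noteq> {}" "AB \<noteq> {}"
    | "BC \<noteq> {}" "AC \<noteq> {}" "AB = {}" | "BC \<noteq> {}" "AB \<noteq> {}" "AC = {}" | "AC \<noteq> {}" "AB \<noteq> {}" "BC = {}"
    | "BC \<noteq> {}" "AC = {}" "AB = {}" | "AC \<noteq> {}" "BC = {}" "AB = {}" | "AB \<noteq> {}" "BC = {}" "AC = {}"
    by blast
  then show ?thesis
  proof cases
    case 1 then show ?thesis by (rule bound_none)
  next
    case 2 then show ?thesis using bound_all by blast
  next
    case 3 then show ?thesis using bound_two by blast
  next
    case 4 then show ?thesis using acb.bound_two unfolding e by blast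
  next
    case 5 then show ?thesis using bca.bound_two unfolding e by blast
  next
    case 6 then show ?thesis using bound_one min3 by blast
  next
    case 7 then show ?thesis using bac.bound_one[OF min3] unfolding e by blast
  next
    case 8 then show ?thesis using cab.bound_one[OF min3] unfolding e by blast
  qed
qed

lemma adj_A:
  assumes "BC = {}" "w \<in> A" "E w u"
  shows "u = a \<or> u \<in> B \<or> u \<in> C"
proof -
  have "u \<in> V" using assms Edom symD by blast
  moreover have "\<not> E a u" "u \<noteq> v" "u \<noteq> b" "u \<noteq> c"
    using assms v_adj triangle symD distinct unfolding mem_cell by blast+
  moreover have "u \<notin> BC" using assms(1) by simp
  moreover have "u \<notin> A" "u \<notin> AB" "u \<notin> AC" "u \<notin> ABC" using \<open>\<not> E a u\<close> by (simp_all add: mem_cell)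
  ultimately show ?thesis using V_cases[of u] by blast
qed

lemma cell_adj: "x \<in> A \<Longrightarrow> E a x" "x \<in> B \<Longrightarrow> E b x" "x \<in> C \<Longrightarrow> E c x"
  by (simp_all add: mem_cell)

end

text \<open>Twins of degree 3 are what blowing up vertices of degree 3 creates; graphs in
  \<open>C33\<close> have none by \<open>twins_imp_proper_blow_up\<close>.\<close>

locale tight_vertex = cubic_vertex +
  assumes tight: tight
    and twin_free: "u \<in> V \<Longrightarrow> w \<in> V \<Longrightarrow> card {x. E u x} = 3 \<Longrightarrow> {x. E u x} = {x. E w x} \<Longrightarrow> u = w"
begin

lemma empty: "AB = {}" "AC = {}" "BC = {}"
  using tight by (simp_all add: tight_def)

lemma mixed:
  "x \<in> A \<Longrightarrow> \<exists>w\<in>B. E x w" "x \<in> A \<Longrightarrow> \<exists>w\<in>C. E x w"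
  "x \<in> B \<Longrightarrow> \<exists>w\<in>A. E x w" "x \<in> B \<Longrightarrow> \<exists>w\<in>C. E x w"
  "x \<in> C \<Longrightarrow> \<exists>w\<in>A. E x w" "x \<in> C \<Longrightarrow> \<exists>w\<in>B. E x w"
  using mixed_cells[OF empty] by blast+

lemma edges_eq: "tri.twice_size = tri.edges + 6"
proof -
  have "card AB = 0" "card AC = 0" "card BC = 0" using empty by simp_all
  moreover have "6 * card V = ec E V V + 30" using tight by (simp add: tight_def)
  ultimately show ?thesis using degree_sum card_V by auto
qed

lemma ABC_empty: "ABC = {}"
proof (rule ccontr)
  assume "ABC \<noteq> {}"
  then obtain w where w: "w \<in> ABC" by blast
  have "{u. E v u} = {a, b, c}" using nbs by auto
  then have "v = w" using nb_ABC[OF w] w vV distinct by (intro twin_free) (auto simp: mem_cell)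
  moreover have "w \<noteq> v" using w by (simp add: mem_cell)
  ultimately show False by blast
qed

lemma adj_B: "w \<in> B \<Longrightarrow> E w u \<Longrightarrow> u = b \<or> u \<in> A \<or> u \<in> C"
proof -
  interpret bac: cubic_vertex V E v b a c by (rule perm_bac)
  show "w \<in> B \<Longrightarrow> E w u \<Longrightarrow> u = b \<or> u \<in> A \<or> u \<in> C" using bac.adj_A empty by blast
qed

lemma adj_C: "w \<in> C \<Longrightarrow> E w u \<Longrightarrow> u = c \<or> u \<in> A \<or> u \<in> B"
proof -
  interpret cab: cubic_vertex V E v c a b by (rule perm_cab)
  show "w \<in> C \<Longrightarrow> E w u \<Longrightarrow> u = c \<or> u \<in> A \<or> u \<in> B" using cab.adj_A empty by blast
qed

text \<open>A vertex \<open>w\<close> of larger degree contradicts equality via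
  \<open>degree_two_edges\<close> with \<open>X = {w}\<close>, as long as a vertex of
  \<open>A\<close> other than \<open>w\<close> misses both \<open>y\<close> and \<open>z\<close>.
  What remains is \<open>w = x'\<close> as the only vertex missing both, and there twin-freeness is
  used.\<close>

lemma degree_two: 
  assumes w: "w \<in> A"
  shows "nb E w B + nb E w C = 2"
proof -
  obtain x x' y z where x: "x \<in> A" "{w \<in> B. E x w} = {y}" "{w \<in> C. E x w} = {z}"
    and x': "x' \<in> A" "\<not> E x' y" "\<not> E x' z"
    using tight unfolding tight_def by blast
  have uy: "w \<in> B \<and> E x w \<longleftrightarrow> w = y" for w using x(2) unfolding set_eq_iff by simp
  have uz: "w \<in> C \<and> E x w \<longleftrightarrow> w = z" for w using x(3) unfolding set_eq_iff by simp
  have two: "2 \<le> nb E w B + nb E w C" if "w \<in> A" for w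
    using tri.degree_ge_two mixed(1,2) that by blast
  have *: "nb E w B + nb E w C = 2" if "w \<in> A" "u \<in> A" "\<not> E u y" "\<not> E u z" "w \<noteq> u" for w u
  proof (rule ccontr)
    assume "nb E w B + nb E w C \<noteq> 2"
    then have "3 \<le> nb E w B + nb E w C" using two[OF that(1)] by linarith
    then have "tri.twice_size + card {w} \<le> tri.edges + 6"
      using tri.degree_two_edges[OF x that(2,3,4) mixed(1,2), of "{w}"] that(1,5) by simp
    then show False using edges_eq by simp
  qed
  show ?thesis
  proof (cases "w = x'")
    case False
    then show ?thesis using * w x' by blast
  next
    case True
    show ?thesis
    proof (cases "\<exists>u\<in>A. u \<noteq> x' \<and> \<not> E u y \<and> \<not> E u z")
      case True
      then show ?thesis using * w \<open>w = x'\<close> by blast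
    next
      case False
      \<comment> \<open>All vertices of \<open>A\<close> besides \<open>x'\<close> now have just
        \<open>y\<close> and \<open>z\<close> as neighbours in \<open>B\<close> and
        \<open>C\<close>. The remaining vertices of \<open>B\<close> and \<open>C\<close> thus have
        \<open>x'\<close> as their only neighbour in \<open>A\<close>.\<close>
      have twin: "{s \<in> B. E u s} = {y} \<and> {s \<in> C. E u s} = {z}" if u: "u \<in> A" "u \<noteq> x'" for u
      proof (rule tri.degree_two_twin[OF x u(1)])
        show "E u y \<or> E u z" using False u by blast
      qed (use mixed(1,2)[OF u(1)] in blast)+
      have Bx': "E s x'" if s: "s \<in> B" "s \<noteq> y" for s
      proof -
        obtain u where u: "u \<in> A" "E s u" using mixed(3)[OF s(1)] by blast
        then have "s \<in> {s \<in> B. E u s}" using s(1) symD by blast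
        then have "u = x'" using twin[OF u(1)] s(2) by auto
        then show ?thesis using u by simp
      qed
      have Cx': "E s x'" if s: "s \<in> C" "s \<noteq> z" for s
      proof -
        obtain u where u: "u \<in> A" "E s u" using mixed(5)[OF s(1)] by blast
        then have "s \<in> {s \<in> C. E u s}" using s(1) symD by blast
        then have "u = x'" using twin[OF u(1)] s(2) by auto
        then show ?thesis using u by simp
      qed
      have Bz: "E s z" if s: "s \<in> B" "s \<noteq> y" for s
      proof -
        have "\<not> E x s" using uy[of s] s by simp
        then obtain t where "t \<in> C" "E x t" "E s t" using tri.satAB[OF x(1) s(1)] by blast
        then show ?thesis using uz[of t] by simp
      qed
      have Cy: "E s y" if s: "s \<in> C" "s \<noteq> z" for s
      proof -
        have "\<not> E x s" using uz[of s] s by simp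
        then obtain t where "t \<in> B" "E x t" "E s t" using tri.satAC[OF x(1) s(1)] by blast
        then show ?thesis using uy[of t] by simp
      qed
      have yz: "y \<in> B" "z \<in> C" using uy uz by blast+
      have ne: "b \<noteq> x'" "b \<noteq> z" "x' \<noteq> z" "c \<noteq> x'" "c \<noteq> y" "x' \<noteq> y"
        using x'(1) yz distinct irrefl abc_nonadj by (auto simp: mem_cell)
      have nB: "{u. E s u} = {b, x', z}" if s: "s \<in> B" "s \<noteq> y" for s
      proof -
        have "u = b \<or> u = x' \<or> u = z" if u: "E s u" for u
        proof -
          consider "u = b" | "u \<in> A" | "u \<in> C" using adj_B[OF s(1) u] by blast
          then show ?thesis
          proof cases
            case 2
            have "u \<noteq> x' \<Longrightarrow> s \<in> {s \<in> B. E u s}" using s(1) symD[OF u] by simp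
            then show ?thesis using twin[OF 2] s(2) by auto
          next
            case 3
            show ?thesis using triangle[OF u Cx'[OF 3] Bx'[OF s]] by blast
          qed simp
        qed
        then show ?thesis using Bx'[OF s] Bz[OF s] symD[OF cell_adj(2)[OF s(1)]] by blast
      qed
      have nC: "{u. E s u} = {c, x', y}" if s: "s \<in> C" "s \<noteq> z" for s
      proof -
        have "u = c \<or> u = x' \<or> u = y" if u: "E s u" for u
        proof -
          consider "u = c" | "u \<in> A" | "u \<in> B" using adj_C[OF s(1) u] by blast
          then show ?thesis
          proof cases
            case 2
            have "u \<noteq> x' \<Longrightarrow> s \<in> {s \<in> C. E u s}" using s(1) symD[OF u] by simp
            then show ?thesis using twin[OF 2] s(2) by auto
          next
            case 3
            show ?thesis using triangle[OF u Bx'[OF 3] Cx'[OF s]] by blast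
          qed simp
        qed
        then show ?thesis using Cx'[OF s] Cy[OF s] symD[OF cell_adj(3)[OF s(1)]] by blast
      qed
      \<comment> \<open>These vertices all have the three neighbours \<open>b\<close>,
        \<open>x'\<close>, \<open>z\<close>, so there is at most one of them. Since
        \<open>x'\<close> misses \<open>y\<close>, it has at most one neighbour in \<open>B\<close>;
        the same works for \<open>C\<close>.\<close>
      have "s = t" if "s \<in> B" "s \<noteq> y" "t \<in> B" "t \<noteq> y" for s t
      proof (rule twin_free)
        show "card {u. E s u} = 3" unfolding nB[OF that(1,2)] using ne by simp
        show "{u. E s u} = {u. E t u}" unfolding nB[OF that(1,2)] nB[OF that(3,4)] ..
      qed (use that in \<open>simp_all add: mem_cell\<close>)
      then have "s = t" if "s \<in> {s \<in> B. E x' s}" "t \<in> {s \<in> B. E x' s}" for s t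
        using that x'(2) by blast
      then have "nb E x' B \<le> Suc 0" unfolding nb_def by (subst card_le_Suc0_iff_eq) auto
      moreover have "s = t" if "s \<in> C" "s \<noteq> z" "t \<in> C" "t \<noteq> z" for s t
      proof (rule twin_free)
        show "card {u. E s u} = 3" unfolding nC[OF that(1,2)] using ne by simp
        show "{u. E s u} = {u. E t u}" unfolding nC[OF that(1,2)] nC[OF that(3,4)] ..
      qed (use that in \<open>simp_all add: mem_cell\<close>)
      then have "s = t" if "s \<in> {s \<in> C. E x' s}" "t \<in> {s \<in> C. E x' s}" for s t
        using that x'(3) by blast
      then have "nb E x' C \<le> Suc 0" unfolding nb_def by (subst card_le_Suc0_iff_eq) auto
      ultimately show ?thesis using two[OF w] \<open>w = x'\<close> by simp
    qed
  qed
qed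

end

section \<open>Recognising the s, x, y, z construction\<close>

lemma sxyz_verts: "pverts (sxyz_graph n) = {Vs} \<union> Vx ` {1..n} \<union> Vy ` {1..n} \<union> Vz ` {1..n}"
  by (simp add: sxyz_graph_def Let_def)

lemma sxyz_arcs:
  "(Vs, Vs) \<notin> parcs (sxyz_graph n)" "(Vs, Vy i) \<notin> parcs (sxyz_graph n)" "(Vs, Vz i) \<notin> parcs (sxyz_graph n)"
  "(Vs, Vx i) \<in> parcs (sxyz_graph n) \<longleftrightarrow> i \<in> {1..n}"
  "(Vx i, Vs) \<in> parcs (sxyz_graph n) \<longleftrightarrow> i \<in> {1..n}"
  "(Vx i, Vx j) \<notin> parcs (sxyz_graph n)"
  "(Vx i, Vy j) \<in> parcs (sxyz_graph n) \<longleftrightarrow> i = j \<and> i \<in> {1..n}"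
  "(Vx i, Vz j) \<in> parcs (sxyz_graph n) \<longleftrightarrow> i = j \<and> i \<in> {1..n}"
  "(Vy i, Vs) \<notin> parcs (sxyz_graph n)"
  "(Vy i, Vx j) \<in> parcs (sxyz_graph n) \<longleftrightarrow> i = j \<and> i \<in> {1..n}"
  "(Vy i, Vy j) \<notin> parcs (sxyz_graph n)"
  "(Vy i, Vz j) \<in> parcs (sxyz_graph n) \<longleftrightarrow> i \<noteq> j \<and> i \<in> {1..n} \<and> j \<in> {1..n}"
  "(Vz i, Vs) \<notin> parcs (sxyz_graph n)"
  "(Vz i, Vx j) \<in> parcs (sxyz_graph n) \<longleftrightarrow> i = j \<and> i \<in> {1..n}"
  "(Vz i, Vy j) \<in> parcs (sxyz_graph n) \<longleftrightarrow> i \<noteq> j \<and> i \<in> {1..n} \<and> j \<in> {1..n}"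
  "(Vz i, Vz j) \<notin> parcs (sxyz_graph n)"
  by (auto simp: sxyz_graph_def Let_def)

text \<open>The neighbourhood \<open>X\<close> of \<open>s\<close> serves as index set:
  \<open>Y\<close> and \<open>Z\<close> send each of its members to its two further neighbours. An
  enumeration of \<open>X\<close> by \<open>{1..n}\<close> then yields the map.\<close>

lemma sxyz_bij:
  fixes E :: "'a \<Rightarrow> 'a \<Rightarrow> bool"
  assumes X: "finite X" "card X = n"
    and V: "V = insert s (X \<union> Y ` X \<union> Z ` X)"
    and inj: "inj_on Y X" "inj_on Z X"
    and disj: "s \<notin> X" "s \<notin> Y ` X" "s \<notin> Z ` X" "X \<inter> Y ` X = {}" "X \<inter> Z ` X = {}" "Y ` X \<inter> Z ` X = {}"
    and sym: "\<And>u w. E u w \<Longrightarrow> E w u"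
    and s: "\<And>w. E s w \<longleftrightarrow> w \<in> X"
    and adj: "\<And>x x'. x \<in> X \<Longrightarrow> x' \<in> X \<Longrightarrow> \<not> E x x'"
      "\<And>x x'. x \<in> X \<Longrightarrow> x' \<in> X \<Longrightarrow> E x (Y x') \<longleftrightarrow> x = x'"
      "\<And>x x'. x \<in> X \<Longrightarrow> x' \<in> X \<Longrightarrow> E x (Z x') \<longleftrightarrow> x = x'"
      "\<And>x x'. x \<in> X \<Longrightarrow> x' \<in> X \<Longrightarrow> \<not> E (Y x) (Y x')"
      "\<And>x x'. x \<in> X \<Longrightarrow> x' \<in> X \<Longrightarrow> \<not> E (Z x) (Z x')"
      "\<And>x x'. x \<in> X \<Longrightarrow> x' \<in> X \<Longrightarrow> E (Y x) (Z x') \<longleftrightarrow> x \<noteq> x'"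
  shows "\<exists>f. bij_betw f (pverts (sxyz_graph n)) V \<and>
    (\<forall>u\<in>pverts (sxyz_graph n). \<forall>w\<in>pverts (sxyz_graph n). (u, w) \<in> parcs (sxyz_graph n) \<longleftrightarrow> E (f u) (f w))"
proof -
  obtain h where h: "bij_betw h {1..n} X"
    using X ex_bij_betw_nat_finite_1 by blast
  define f where "f = (\<lambda>u. case u of Vs \<Rightarrow> s | Vx i \<Rightarrow> h i | Vy i \<Rightarrow> Y (h i) | Vz i \<Rightarrow> Z (h i))"
  have f: "f Vs = s" "f (Vx i) = h i" "f (Vy i) = Y (h i)" "f (Vz i) = Z (h i)" for i
    by (simp_all add: f_def)
  have hX: "h i \<in> X" if "i \<in> {1..n}" for i using h that by (rule bij_betw_apply)
  have hinj: "h i = h j \<longleftrightarrow> i = j" if "i \<in> {1..n}" "j \<in> {1..n}" for i j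
    using bij_betw_imp_inj_on[OF h] that by (rule inj_on_eq_iff)
  have Yinj: "Y (h i) = Y (h j) \<longleftrightarrow> i = j" "Z (h i) = Z (h j) \<longleftrightarrow> i = j"
    if "i \<in> {1..n}" "j \<in> {1..n}" for i j
    using inj_on_eq_iff[OF inj(1) hX hX] inj_on_eq_iff[OF inj(2) hX hX] that hinj by simp_all
  have ne: "s \<noteq> h i" "s \<noteq> Y (h i)" "s \<noteq> Z (h i)" "h i \<noteq> Y (h j)" "h i \<noteq> Z (h j)" "Y (h i) \<noteq> Z (h j)"
    if "i \<in> {1..n}" "j \<in> {1..n}" for i j
    using disj hX[OF that(1)] hX[OF that(2)] by blast+
  let ?P = "pverts (sxyz_graph n)"
  have "inj_on f ?P"
  proof (rule inj_onI)
    fix u w assume u: "u \<in> ?P" and w: "w \<in> ?P" and eq: "f u = f w"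
    show "u = w"
      by (cases u; cases w; use u w eq ne ne[symmetric] in \<open>simp add: f sxyz_verts image_iff hinj Yinj\<close>)
  qed
  moreover have "f ` ?P = V"
  proof -
    have "f ` ?P = insert s (h ` {1..n} \<union> Y ` h ` {1..n} \<union> Z ` h ` {1..n})"
      unfolding sxyz_verts image_Un image_image by (simp add: f)
    then show ?thesis using V bij_betw_imp_surj_on[OF h] by simp
  qed
  moreover have "(u, w) \<in> parcs (sxyz_graph n) \<longleftrightarrow> E (f u) (f w)" if u: "u \<in> ?P" and w: "w \<in> ?P" for u w
  proof -
    have 1: "E (h i) (h j) \<longleftrightarrow> False" "E (h i) (Y (h j)) \<longleftrightarrow> i = j" "E (h i) (Z (h j)) \<longleftrightarrow> i = j"
      "E (Y (h i)) (h j) \<longleftrightarrow> i = j" "E (Z (h i)) (h j) \<longleftrightarrow> i = j"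
      "E (Y (h i)) (Y (h j)) \<longleftrightarrow> False" "E (Z (h i)) (Z (h j)) \<longleftrightarrow> False"
      "E (Y (h i)) (Z (h j)) \<longleftrightarrow> i \<noteq> j" "E (Z (h i)) (Y (h j)) \<longleftrightarrow> i \<noteq> j"
      if i: "i \<in> {1..n}" and j: "j \<in> {1..n}" for i j
    proof -
      note a = adj[OF hX[OF i] hX[OF j], unfolded hinj[OF i j]]
      note b = adj[OF hX[OF j] hX[OF i], unfolded hinj[OF j i]]
      show "E (h i) (h j) \<longleftrightarrow> False" "E (h i) (Y (h j)) \<longleftrightarrow> i = j" "E (h i) (Z (h j)) \<longleftrightarrow> i = j"
        "E (Y (h i)) (Y (h j)) \<longleftrightarrow> False" "E (Z (h i)) (Z (h j)) \<longleftrightarrow> False"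
        "E (Y (h i)) (Z (h j)) \<longleftrightarrow> i \<noteq> j" using a by simp_all
      show "E (Y (h i)) (h j) \<longleftrightarrow> i = j" "E (Z (h i)) (h j) \<longleftrightarrow> i = j" "E (Z (h i)) (Y (h j)) \<longleftrightarrow> i \<noteq> j"
        using b sym by blast+
    qed
    have 2: "E s (h i)" "E (h i) s" "\<not> E s (Y (h i))" "\<not> E s (Z (h i))" "\<not> E (Y (h i)) s" "\<not> E (Z (h i)) s"
      if i: "i \<in> {1..n}" for i
      using s sym hX[OF i] disj(4,5) by blast+
    have 3: "\<not> E s s" using s disj by blast
    show ?thesis
      by (cases u; cases w; use u w in \<open>simp add: f sxyz_verts image_iff sxyz_arcs 1 2 3\<close>)
  qed
  ultimately show ?thesis unfolding bij_betw_def by blast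
qed

context tight_vertex
begin

lemma sxyz_structure:
  "\<exists>f n. 3 \<le> n \<and> bij_betw f (pverts (sxyz_graph n)) V \<and>
    (\<forall>u\<in>pverts (sxyz_graph n). \<forall>w\<in>pverts (sxyz_graph n). (u, w) \<in> parcs (sxyz_graph n) \<longleftrightarrow> E (f u) (f w))"
proof -
  have "\<exists>y z. {u \<in> B. E w u} = {y} \<and> {u \<in> C. E w u} = {z}" if w: "w \<in> A" for w
  proof -
    obtain y z where "{u \<in> B. E w u} = {y}" "{u \<in> C. E w u} = {z}"
      by (rule tri.degree_two_singletons[OF w degree_two[OF w] mixed(1)[OF w] mixed(2)[OF w]])
    then show ?thesis by (intro exI conjI)
  qed
  then obtain Y Z where YZ: "\<And>w. w \<in> A \<Longrightarrow> {u \<in> B. E w u} = {Y w}" "\<And>w. w \<in> A \<Longrightarrow> {u \<in> C. E w u} = {Z w}"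
    by metis
  have Y: "u \<in> B \<and> E w u \<longleftrightarrow> u = Y w" if "w \<in> A" for w u
    using YZ(1)[OF that] unfolding set_eq_iff by simp
  have Z: "u \<in> C \<and> E w u \<longleftrightarrow> u = Z w" if "w \<in> A" for w u
    using YZ(2)[OF that] unfolding set_eq_iff by simp
  have YB: "Y w \<in> B" "E w (Y w)" and ZC: "Z w \<in> C" "E w (Z w)" if "w \<in> A" for w
    using Y[OF that] Z[OF that] by blast+
  have adjA: "E w u \<longleftrightarrow> u = a \<or> u = Y w \<or> u = Z w" if w: "w \<in> A" for w u
    using adj_A[OF empty(3) w, of u] Y[OF w, of u] Z[OF w, of u] symD[OF cell_adj(1)[OF w]] by blast
  have a_notin: "a \<notin> A" "a \<notin> B" "a \<notin> C" "b \<notin> A" "b \<notin> B" "b \<notin> C" "c \<notin> A" "c \<notin> B" "c \<notin> C" "v \<notin> A" "v \<notin> B" "v \<notin> C"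
    by (simp_all add: not_in_cell)
  have cd: "A \<inter> B = {}" "A \<inter> C = {}" "B \<inter> C = {}" by (simp_all add: cells_disjoint)
  have nonadj: "\<not> E w u" if "w \<in> A \<and> u \<in> A \<or> w \<in> B \<and> u \<in> B \<or> w \<in> C \<and> u \<in> C" for w u
    using that nonadj_cells[of w "{a}" u "{a}" a] nonadj_cells[of w "{b}" u "{b}" b] nonadj_cells[of w "{c}" u "{c}" c]
    by auto
  have nbd: "{u. E w u} = {a, Y w, Z w}" "card {u. E w u} = 3" if w: "w \<in> A" for w
  proof -
    show "{u. E w u} = {a, Y w, Z w}" using adjA[OF w] by auto
    moreover have "a \<noteq> Y w" "a \<noteq> Z w" "Y w \<noteq> Z w" using YB(1)[OF w] ZC(1)[OF w] a_notin cd by auto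
    ultimately show "card {u. E w u} = 3" by simp
  qed
  have twin: "w = u" if "w \<in> A" "u \<in> A" "Y w = Y u" "Z w = Z u" for w u
    using twin_free[of w u] nbd[OF that(1)] nbd[OF that(2)] that by (simp add: mem_cell)
  \<comment> \<open>If \<open>Y w = Y u\<close> for distinct \<open>w\<close> and \<open>u\<close>,
    then \<open>w\<close> and \<open>Z u\<close> are non-adjacent, and their common neighbour in
    \<open>B\<close> can only be \<open>Y u\<close>, which closes a triangle with \<open>u\<close>
    and \<open>Z u\<close>.\<close>
  have injY: "w = u" if w: "w \<in> A" and u: "u \<in> A" and eq: "Y w = Y u" for w u
  proof (rule ccontr)
    assume "w \<noteq> u"
    then have "Z w \<noteq> Z u" using twin[OF w u eq] by blast
    then have "\<not> E w (Z u)" using Z[OF w, of "Z u"] ZC(1)[OF u] by auto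
    then obtain t where "t \<in> B" "E w t" "E (Z u) t" using tri.satAC[OF w ZC(1)[OF u]] by blast
    then have "E (Z u) (Y u)" using Y[OF w, of t] eq by simp
    then show False using triangle[OF symD[OF ZC(2)[OF u]] YB(2)[OF u]] by blast
  qed
  have injZ: "w = u" if w: "w \<in> A" and u: "u \<in> A" and eq: "Z w = Z u" for w u
  proof (rule ccontr)
    assume "w \<noteq> u"
    then have "Y w \<noteq> Y u" using twin[OF w u] eq by blast
    then have "\<not> E w (Y u)" using Y[OF w, of "Y u"] YB(1)[OF u] by auto
    then obtain t where "t \<in> C" "E w t" "E (Y u) t" using tri.satAB[OF w YB(1)[OF u]] by blast
    then have "E (Y u) (Z u)" using Z[OF w, of t] eq by simp
    then show False using triangle[OF symD[OF YB(2)[OF u]] ZC(2)[OF u]] by blast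
  qed
  have YAZ: "E (Y w) (Z u) \<longleftrightarrow> w \<noteq> u" if w: "w \<in> A" and u: "u \<in> A" for w u
  proof
    assume "E (Y w) (Z u)"
    then show "w \<noteq> u" using triangle[OF YB(2)[OF w]] ZC(2)[OF u] by blast
  next
    assume "w \<noteq> u"
    then have "\<not> E w (Z u)" using Z[OF w, of "Z u"] ZC(1)[OF u] injZ[OF w u] by auto
    then obtain t where "t \<in> B" "E w t" "E (Z u) t" using tri.satAC[OF w ZC(1)[OF u]] by blast
    then show "E (Y w) (Z u)" using Y[OF w, of t] symD by blast
  qed
  have BY: "B = Y ` A"
  proof (intro equalityI subsetI)
    fix u assume u: "u \<in> B"
    then obtain w where w: "w \<in> A" "E u w" using mixed(3) by blast
    then show "u \<in> Y ` A" using Y[OF w(1), of u] u symD by blast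
  qed (use YB in blast)
  have CZ: "C = Z ` A"
  proof (intro equalityI subsetI)
    fix u assume u: "u \<in> C"
    then obtain w where w: "w \<in> A" "E u w" using mixed(5) by blast
    then show "u \<in> Z ` A" using Z[OF w(1), of u] u symD by blast
  qed (use ZC in blast)
  \<comment> \<open>The centre \<open>s\<close> is \<open>a\<close>, not \<open>v\<close>: the
    neighbours of \<open>a\<close> are \<open>v\<close> and the vertices of \<open>A\<close>. The
    remaining neighbours of \<open>v\<close> are \<open>c\<close> and \<open>b\<close>; since
    \<open>c\<close> is adjacent to all of \<open>C\<close> and \<open>b\<close> to all of
    \<open>B\<close>, \<open>c\<close> plays the \<open>y\<close> and \<open>b\<close> the
    \<open>z\<close> belonging to \<open>v\<close>.\<close>
  define X where "X = insert v A"
  define Y' where "Y' = (\<lambda>w. if w = v then c else Y w)"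
  define Z' where "Z' = (\<lambda>w. if w = v then b else Z w)"
  have XY: "Y' ` X = insert c B" "Z' ` X = insert b C"
    using a_notin BY CZ unfolding X_def Y'_def Z'_def by auto
  have v_ne: "v \<noteq> a" "v \<noteq> b" "v \<noteq> c" using v_adj irrefl by blast+
  have V: "V = insert a (X \<union> Y' ` X \<union> Z' ` X)"
    unfolding XY unfolding X_def using V_eq empty ABC_empty by auto
  have notadj: "\<not> E v w" "\<not> E w v" if "w \<in> A \<union> B \<union> C" for w
    using nbs[of w] a_notin that symD[of w v] by auto
  have adj_a: "E a w \<longleftrightarrow> w \<in> X" for w
  proof
    assume *: "E a w"
    then have "w \<in> V" using Edom symD by blast
    moreover have "w \<notin> B" "w \<notin> C" using * distinct by (simp_all add: mem_cell)
    moreover have "w \<noteq> a" "w \<noteq> b" "w \<noteq> c" using * abc_nonadj irrefl by auto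
    ultimately show "w \<in> X" using V_cases[of w] empty ABC_empty unfolding X_def by simp
  qed (use v_adj cell_adj X_def in auto)
  have Bc: "E u b" "\<not> E u c" "\<not> E c u" if "u \<in> B" for u
    using that distinct symD by (auto simp: mem_cell)
  have Cb: "E u c" "E c u" "\<not> E u b" "\<not> E b u" if "u \<in> C" for u
    using that distinct symD by (auto simp: mem_cell)
  have Abc: "\<not> E w b" "\<not> E w c" if "w \<in> A" for w
    using that distinct symD by (auto simp: mem_cell)
  have Y': "Y' v = c" "Z' v = b" "w \<in> A \<Longrightarrow> Y' w = Y w" "w \<in> A \<Longrightarrow> Z' w = Z w" for w
    using a_notin by (auto simp: Y'_def Z'_def)
  have EY: "E w (Y u) \<longleftrightarrow> w = u" "E w (Z u) \<longleftrightarrow> w = u" if w: "w \<in> A" and u: "u \<in> A" for w u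
  proof -
    have "Y u = Y w" if "E w (Y u)" using that Y[OF w, of "Y u"] YB(1)[OF u] by blast
    then show "E w (Y u) \<longleftrightarrow> w = u" using injY[OF w u] YB(2)[OF u] by metis
    have "Z u = Z w" if "E w (Z u)" using that Z[OF w, of "Z u"] ZC(1)[OF u] by blast
    then show "E w (Z u) \<longleftrightarrow> w = u" using injZ[OF w u] ZC(2)[OF u] by metis
  qed
  have YY: "\<not> E (Y w) (Y u)" "\<not> E (Z w) (Z u)" if w: "w \<in> A" and u: "u \<in> A" for w u
    using nonadj[of "Y w" "Y u"] nonadj[of "Z w" "Z u"] YB(1)[OF w] YB(1)[OF u] ZC(1)[OF w] ZC(1)[OF u] by blast+
  have nY: "E (Y w) b" "\<not> E (Y w) c" "\<not> E c (Y w)" "E c (Z w)" "\<not> E (Z w) b" "\<not> E b (Z w)" if w: "w \<in> A" for w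
    using Bc[OF YB(1)[OF w]] Cb[OF ZC(1)[OF w]] by blast+
  have nv: "\<not> E v (Y w)" "\<not> E v (Z w)" if w: "w \<in> A" for w
    using notadj YB(1)[OF w] ZC(1)[OF w] by blast+
  have fX: "finite X" by (simp add: X_def)
  have "\<exists>f. bij_betw f (pverts (sxyz_graph (card X))) V \<and>
    (\<forall>u\<in>pverts (sxyz_graph (card X)). \<forall>w\<in>pverts (sxyz_graph (card X)). (u, w) \<in> parcs (sxyz_graph (card X)) \<longleftrightarrow> E (f u) (f w))"
  proof (rule sxyz_bij[OF fX refl V])
    show "inj_on Y' X" 
      using injY YB(1) a_notin unfolding inj_on_def X_def Y'_def by auto
    show "inj_on Z' X"
      using injZ ZC(1) a_notin unfolding inj_on_def X_def Z'_def by auto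
    show "a \<notin> X" "a \<notin> Y' ` X" "a \<notin> Z' ` X" "X \<inter> Y' ` X = {}" "X \<inter> Z' ` X = {}" "Y' ` X \<inter> Z' ` X = {}"
      unfolding XY unfolding X_def using a_notin v_ne distinct cd by auto
    show "\<And>u w. E u w \<Longrightarrow> E w u" by (rule symD)
    show "\<And>w. E a w \<longleftrightarrow> w \<in> X" by (rule adj_a)
    fix x x' assume x: "x \<in> X" "x' \<in> X"
    then consider "x = v" "x' = v" | "x = v" "x' \<in> A" "x' \<noteq> v" | "x \<in> A" "x \<noteq> v" "x' = v" | "x \<in> A" "x \<noteq> v" "x' \<in> A" "x' \<noteq> v"
      using a_notin unfolding X_def by blast
    note cs = this
    show "\<not> E x x'"
      by (cases rule: cs) (simp_all add: irrefl notadj nonadj)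
    show "E x (Y' x') \<longleftrightarrow> x = x'" "E x (Z' x') \<longleftrightarrow> x = x'"
      by (cases rule: cs; simp add: Y' v_adj nv Abc EY)+
    show "\<not> E (Y' x) (Y' x')" "\<not> E (Z' x) (Z' x')"
      by (cases rule: cs; simp add: Y' irrefl YY nY)+
    show "E (Y' x) (Z' x') \<longleftrightarrow> x \<noteq> x'"
      by (cases rule: cs; simp add: Y' abc_nonadj YAZ nY)
  qed
  moreover have "3 \<le> card X"
  proof -
    obtain x x' y z where "x \<in> A" "x' \<in> A" "{w \<in> B. E x w} = {y}" "\<not> E x' y"
      using tight unfolding tight_def by blast
    then have "x \<noteq> x'" by blast
    then have "card {x, x'} = 2" by simp
    moreover have "card {x, x'} \<le> card A" using \<open>x \<in> A\<close> \<open>x' \<in> A\<close> by (intro card_mono) auto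
    ultimately show ?thesis using a_notin by (simp add: X_def)
  qed
  ultimately show ?thesis by blast
qed

end

section \<open>Isomorphisms\<close>

abbreviation adj :: "'a pair_pre_digraph \<Rightarrow> 'a \<Rightarrow> 'a \<Rightarrow> bool" where
  "adj G u w \<equiv> (u, w) \<in> parcs G"

text \<open>Nothing is required of \<open>E'\<close> outside \<open>V'\<close>, whence the extra
  assumption \<open>dom\<close> in \<open>saturated_adj_iso\<close>.\<close>

definition adj_iso :: "('a \<Rightarrow> 'b) \<Rightarrow> 'a set \<Rightarrow> ('a \<Rightarrow> 'a \<Rightarrow> bool) \<Rightarrow> 'b set \<Rightarrow> ('b \<Rightarrow> 'b \<Rightarrow> bool) \<Rightarrow> bool" where
  "adj_iso f V E V' E' \<longleftrightarrow> bij_betw f V V' \<and> (\<forall>u\<in>V. \<forall>w\<in>V. E u w \<longleftrightarrow> E' (f u) (f w))"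

lemma adj_iso_inv:
  assumes "adj_iso f V E V' E'"
  shows "adj_iso (inv_into V f) V' E' V E"
proof -
  have "bij_betw f V V'" using assms by (simp add: adj_iso_def)
  then have "bij_betw (inv_into V f) V' V" "\<And>x. x \<in> V' \<Longrightarrow> f (inv_into V f x) = x"
    by (auto intro: bij_betw_inv_into bij_betw_inv_into_right)
  moreover from this have "\<And>x. x \<in> V' \<Longrightarrow> inv_into V f x \<in> V" by (blast dest: bij_betw_apply)
  ultimately show ?thesis using assms by (simp add: adj_iso_def)
qed

lemma nb_adj_iso:
  assumes "adj_iso f V E V' E'" "u \<in> V"
  shows "nb E' (f u) V' = nb E u V"
proof -
  have f: "inj_on f V" "f ` V = V'" using assms(1) by (auto simp: adj_iso_def bij_betw_def)
  have "{w \<in> V'. E' (f u) w} = f ` {w \<in> V. E u w}" using assms f(2) by (auto simp: adj_iso_def)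
  then show ?thesis unfolding nb_def using f(1) by (simp add: card_image inj_on_subset)
qed

lemma ec_adj_iso:
  assumes "adj_iso f V E V' E'"
  shows "ec E' V' V' = ec E V V"
proof -
  have f: "bij_betw f V V'" using assms by (simp add: adj_iso_def)
  show ?thesis unfolding ec_def
    by (subst sum.reindex_bij_betw[OF f, symmetric]) (simp add: nb_adj_iso[OF assms])
qed

lemma card_adj_iso: "adj_iso f V E V' E' \<Longrightarrow> card V' = card V"
  by (auto simp: adj_iso_def dest: bij_betw_same_card)

lemma saturated_adj_iso:
  assumes iso: "adj_iso f V E V' E'" and sat: "saturated V E"
    and dom: "\<And>x y. E' x y \<Longrightarrow> x \<in> V' \<and> y \<in> V'"
  shows "saturated V' E'"
proof -
  interpret saturated V E by (rule sat)
  have f: "V' = f ` V" and inj: "inj_on f V" using iso by (auto simp: adj_iso_def bij_betw_def)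
  have E': "E' (f u) (f w) \<longleftrightarrow> E u w" if "u \<in> V" "w \<in> V" for u w
    using iso that by (simp add: adj_iso_def)
  show ?thesis
  proof
    show "finite V'" by (simp add: f)
    have sym: "E' y x" if xy: "E' x y" for x y
    proof -
      obtain u w where "x = f u" "y = f w" "u \<in> V" "w \<in> V" using dom[OF xy] f by blast
      then show ?thesis using xy E' symD by blast
    qed
    then show "E' x y \<longleftrightarrow> E' y x" for x y by blast
    show "E' x y \<Longrightarrow> x \<in> V'" for x y using dom by blast
    show False if xyz: "E' x y" "E' y z" "E' x z" for x y z
    proof -
      obtain u w t where "x = f u" "y = f w" "z = f t" "u \<in> V" "w \<in> V" "t \<in> V"
        using dom[OF xyz(1)] dom[OF xyz(2)] f by blast
      then show ?thesis using xyz E' triangle by blast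
    qed
    show "\<exists>z. E' x z \<and> E' y z" if xy: "x \<in> V'" "y \<in> V'" "x \<noteq> y" "\<not> E' x y" for x y
    proof -
      obtain u w where u: "x = f u" "y = f w" "u \<in> V" "w \<in> V" using xy(1,2) f by blast
      then obtain t where t: "E u t" "E w t" using common[of u w] xy E' by blast
      then have "t \<in> V" using Edom symD by blast
      then show ?thesis using t u E' by blast
    qed
  qed
qed

section \<open>Library graphs and adjacency predicates\<close>

lemma wf_with_proj: "wf_digraph (with_proj G) \<longleftrightarrow> pair_wf_digraph G"
  unfolding wf_digraph_def pair_wf_digraph_def by simp

lemma pair_wf_iff: "pair_wf_digraph G \<longleftrightarrow> (\<forall>u w. adj G u w \<longrightarrow> u \<in> pverts G \<and> w \<in> pverts G)"
  unfolding pair_wf_digraph_def by auto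

text \<open>A library isomorphism carries a separate map on arcs. As arcs are pairs with
  \<open>fst\<close> and \<open>snd\<close> as ends, that map is determined on the arcs by the
  vertex map \<open>f\<close> and can be taken as \<open>map_prod f f\<close>.\<close>

lemma graph_iso_iff:
  "graph_iso G H \<longleftrightarrow> pair_wf_digraph G \<and> pair_wf_digraph H \<and>
    (\<exists>f. adj_iso f (pverts G) (adj G) (pverts H) (adj H))" (is "?L \<longleftrightarrow> ?R")
proof
  assume ?L
  then obtain h where h: "pre_digraph.digraph_isomorphism (with_proj G) h" "with_proj H = app_iso h (with_proj G)"
    unfolding digraph_iso_def by blast
  let ?f = "iso_verts h"
  have wf: "pair_wf_digraph G" and inj: "inj_on ?f (pverts G)"
    and tl: "\<And>e. e \<in> parcs G \<Longrightarrow> ?f (fst e) = iso_tail h (iso_arcs h e) \<and> ?f (snd e) = iso_head h (iso_arcs h e)"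
    using h(1) unfolding pre_digraph.digraph_isomorphism_def by (auto simp: wf_with_proj)
  have V: "pverts H = ?f ` pverts G" and A: "parcs H = iso_arcs h ` parcs G"
    and th: "fst = iso_tail h" "snd = iso_head h"
    using arg_cong[OF h(2), of verts] arg_cong[OF h(2), of arcs] arg_cong[OF h(2), of tail]
      arg_cong[OF h(2), of head] by simp_all
  have "iso_arcs h e = (?f (fst e), ?f (snd e))" if "e \<in> parcs G" for e
    using tl[OF that] by (simp add: prod_eq_iff flip: th)
  then have A': "parcs H = (\<lambda>e. (?f (fst e), ?f (snd e))) ` parcs G" unfolding A by (rule image_cong[OF refl])
  have "adj G u w \<longleftrightarrow> adj H (?f u) (?f w)" if "u \<in> pverts G" "w \<in> pverts G" for u w
  proof
    assume "adj G u w" then show "adj H (?f u) (?f w)" unfolding A' by force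
  next
    assume "adj H (?f u) (?f w)"
    then obtain e where e: "e \<in> parcs G" "?f u = ?f (fst e)" "?f w = ?f (snd e)" unfolding A' by auto
    moreover have "fst e \<in> pverts G" "snd e \<in> pverts G" using wf e(1) unfolding pair_wf_digraph_def by blast+
    ultimately have "u = fst e" "w = snd e" using inj that by (auto dest: inj_onD)
    then show "adj G u w" using e(1) by simp
  qed
  moreover have "pair_wf_digraph H" using wf unfolding pair_wf_digraph_def A' V by auto
  ultimately show ?R using wf inj V unfolding adj_iso_def bij_betw_def by blast
next
  assume ?R
  then obtain f where wf: "pair_wf_digraph G" "pair_wf_digraph H"
    and f: "inj_on f (pverts G)" "f ` pverts G = pverts H"
    and E: "\<And>u w. u \<in> pverts G \<Longrightarrow> w \<in> pverts G \<Longrightarrow> adj G u w \<longleftrightarrow> adj H (f u) (f w)"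
    unfolding adj_iso_def bij_betw_def by blast
  define h where "h = \<lparr>iso_verts = f, iso_arcs = map_prod f f, iso_head = snd, iso_tail = fst\<rparr>"
  have "inj_on (map_prod f f) (parcs G)"
  proof (rule inj_on_subset)
    show "inj_on (map_prod f f) (pverts G \<times> pverts G)" using f(1) f(1) by (rule map_prod_inj_on)
    show "parcs G \<subseteq> pverts G \<times> pverts G" using wf(1) unfolding pair_wf_iff by auto
  qed
  then have "pre_digraph.digraph_isomorphism (with_proj G) h"
    unfolding pre_digraph.digraph_isomorphism_def h_def using f wf(1) by (auto simp: wf_with_proj)
  moreover have "parcs H = map_prod f f ` parcs G"
  proof (intro equalityI subrelI)
    fix x y assume xy: "(x, y) \<in> parcs H"
    then obtain u w where "x = f u" "y = f w" "u \<in> pverts G" "w \<in> pverts G"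
      using wf(2) f(2) unfolding pair_wf_iff by blast
    then show "(x, y) \<in> map_prod f f ` parcs G" using xy E by force
  qed (use E wf(1) in \<open>auto simp: pair_wf_iff\<close>)
  then have "with_proj H = app_iso h (with_proj G)"
    unfolding with_proj_def app_iso_def h_def using f(2) by simp
  ultimately show ?L unfolding digraph_iso_def by blast
qed

lemma degree_eq_nb:
  assumes "pair_wf_digraph G"
  shows "degree G u = nb (adj G) u (pverts G)"
proof -
  have "out_arcs (with_proj G) u = Pair u ` {w \<in> pverts G. adj G u w}"
    using assms unfolding out_arcs_def pair_wf_iff by auto
  then show ?thesis unfolding out_degree_def nb_def by (simp add: card_image inj_on_def)
qed

text \<open>A triangle in the enlarged graph must use the new edge, and its third vertex is a common
  neighbour of \<open>u\<close> and \<open>v\<close>.\<close>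

lemma triangle_free_add_edge:
  assumes "triangle_free G" "sym (parcs G)" "irrefl (parcs G)" "u \<noteq> v" "\<not> adj G u v"
  shows "triangle_free (add_edge u v G) \<longleftrightarrow> \<not> (\<exists>w. adj G u w \<and> adj G v w)"
proof
  assume tf: "triangle_free (add_edge u v G)"
  show "\<not> (\<exists>w. adj G u w \<and> adj G v w)"
  proof
    assume "\<exists>w. adj G u w \<and> adj G v w"
    then obtain w where "adj G u w" "adj G w v" using symD[OF assms(2)] by blast
    then have "adj (add_edge u v G) u w" "adj (add_edge u v G) w v" "adj (add_edge u v G) v u"
      by (simp_all add: add_edge_def)
    then show False using tf unfolding triangle_free_def by blast
  qed
next
  assume no: "\<not> (\<exists>w. adj G u w \<and> adj G v w)"
  have s: "\<And>x y. adj G x y \<Longrightarrow> adj G y x" using symD[OF assms(2)] by blast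
  have i: "\<And>x. \<not> adj G x x" using assms(3) by (simp add: irrefl_def)
  show "triangle_free (add_edge u v G)"
    unfolding triangle_free_def
  proof (intro notI, elim exE conjE)
    fix x y z assume "adj (add_edge u v G) x y" "adj (add_edge u v G) y z" "adj (add_edge u v G) z x"
    then have "adj G x y \<or> x = u \<and> y = v \<or> x = v \<and> y = u" "adj G y z \<or> y = u \<and> z = v \<or> y = v \<and> z = u"
      "adj G z x \<or> z = u \<and> x = v \<or> z = v \<and> x = u"
      by (auto simp: add_edge_def)
    moreover have "\<not> (adj G x y \<and> adj G y z \<and> adj G z x)" using assms(1) unfolding triangle_free_def by blast
    ultimately show False using no s i assms(4) by (elim disjE conjE) blast+
  qed
qed

lemma K3_saturated_iff:
  "K3_saturated G \<longleftrightarrow> saturated (pverts G) (adj G)"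
proof
  assume G: "K3_saturated G"
  then interpret pair_graph G by (simp add: K3_saturated_def)
  have s: "sym (parcs G)" using pair_sym_arcs by (simp add: symmetric_def)
  have i: "irrefl (parcs G)" using pair_no_loops by (force simp: irrefl_def)
  show "saturated (pverts G) (adj G)"
  proof
    show "finite (pverts G)" by (rule pair_finite_verts)
    show "adj G u v \<longleftrightarrow> adj G v u" for u v using symD[OF s] by blast
    show "adj G u v \<Longrightarrow> u \<in> pverts G" for u v using in_arcsD1 by blast
    show "adj G u v \<Longrightarrow> adj G v w \<Longrightarrow> adj G u w \<Longrightarrow> False" for u v w
      using G symD[OF s, of u w] unfolding K3_saturated_def triangle_free_def by blast
    show "\<exists>w. adj G u w \<and> adj G v w" if "u \<in> pverts G" "v \<in> pverts G" "u \<noteq> v" "\<not> adj G u v" for u v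
      using triangle_free_add_edge[OF _ s i that(3,4)] G that unfolding K3_saturated_def by blast
  qed
next
  assume "saturated (pverts G) (adj G)"
  then interpret saturated "pverts G" "adj G" .
  have s: "sym (parcs G)" using symD by (blast intro: symI)
  have i: "irrefl (parcs G)" using irrefl by (simp add: irrefl_def)
  have wf: "pair_wf_digraph G" unfolding pair_wf_iff using Edom symD by blast
  have "parcs G \<subseteq> pverts G \<times> pverts G" using wf unfolding pair_wf_iff by auto
  then have "finite (parcs G)" by (rule finite_subset) simp
  moreover have "fst e \<noteq> snd e" if "e \<in> parcs G" for e
    using that i by (cases e) (auto simp: irrefl_def)
  ultimately have "pair_graph G"
    using wf s finV
    unfolding pair_graph_def pair_digraph_def pair_pseudo_graph_def pair_fin_digraph_def pair_sym_digraph_def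
      pair_loopfree_digraph_def pair_fin_digraph_axioms_def pair_sym_digraph_axioms_def
      pair_loopfree_digraph_axioms_def symmetric_def by simp
  moreover have tf: "triangle_free G" unfolding triangle_free_def using triangle symD by blast
  ultimately show "K3_saturated G"
    unfolding K3_saturated_def using triangle_free_add_edge[OF tf s i] common by blast
qed

section \<open>Weight\<close>

text \<open>Each edge is the image of exactly two arcs, which are distinct because there are no
  loops.\<close>

lemma two_num_edges:
  assumes "saturated (pverts G) (adj G)"
  shows "2 * num_edges G = ec (adj G) (pverts G) (pverts G)"
proof -
  interpret saturated "pverts G" "adj G" by (rule assms)
  let ?e = "\<lambda>(u, v). {u, v}"
  have "parcs G \<subseteq> pverts G \<times> pverts G" using Edom symD by auto
  then have fin: "finite (parcs G)" by (rule finite_subset) simp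
  have fib: "card {p \<in> parcs G. ?e p = y} = 2" if y: "y \<in> ?e ` parcs G" for y
  proof -
    obtain p where p: "p \<in> parcs G" "y = ?e p" using y by blast
    obtain u v where "p = (u, v)" by (cases p)
    then have uv: "adj G u v" "y = {u, v}" using p by simp_all
    have "q \<in> {p \<in> parcs G. ?e p = y} \<longleftrightarrow> q \<in> {(u, v), (v, u)}" for q
      using uv(1) symD[OF uv(1)] by (cases q) (auto simp: uv(2) doubleton_eq_iff)
    then have "{p \<in> parcs G. ?e p = y} = {(u, v), (v, u)}" by (rule set_eqI)
    moreover have "u \<noteq> v" using uv(1) irrefl by blast
    ultimately show ?thesis by simp
  qed
  have "card (parcs G) = (\<Sum>y\<in>?e ` parcs G. card {p \<in> parcs G. ?e p = y})"
    using sum.image_gen[OF fin, of "\<lambda>_. 1 :: nat" ?e] by simp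
  also have "\<dots> = 2 * num_edges G" using fib by (simp add: num_edges_def)
  finally have "2 * num_edges G = card (parcs G)" by simp
  also have "parcs G = Sigma (pverts G) (\<lambda>u. {w \<in> pverts G. adj G u w})" using Edom symD by auto
  also have "card \<dots> = ec (adj G) (pverts G) (pverts G)" by (simp add: card_SigmaI ec_def nb_def)
  finally show ?thesis .
qed

lemma min_degree_eq_3_iff:
  assumes "saturated (pverts G) (adj G)"
  shows "min_degree G = 3 \<longleftrightarrow> (\<exists>v\<in>pverts G. nb (adj G) v (pverts G) = 3) \<and>
    (\<forall>v\<in>pverts G. 3 \<le> nb (adj G) v (pverts G))"
proof -
  interpret saturated "pverts G" "adj G" by (rule assms)
  have "pair_wf_digraph G" unfolding pair_wf_iff using Edom symD by blast
  then have d: "degree G = (\<lambda>v. nb (adj G) v (pverts G))" by (intro ext degree_eq_nb)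
  show ?thesis
  proof (cases "pverts G = {}")
    case False
    then show ?thesis unfolding min_degree_def d by (auto simp: Min_eq_iff)
  qed (simp add: min_degree_def)
qed

definition cubic_saturated :: "'a pair_pre_digraph \<Rightarrow> bool" where
  "cubic_saturated G \<longleftrightarrow> saturated (pverts G) (adj G) \<and> (\<exists>v\<in>pverts G. nb (adj G) v (pverts G) = 3) \<and>
    (\<forall>v\<in>pverts G. 3 \<le> nb (adj G) v (pverts G))"

lemma cubic_saturated_iff: "cubic_saturated G \<longleftrightarrow> K3_saturated G \<and> min_degree G = 3"
  unfolding cubic_saturated_def K3_saturated_iff using min_degree_eq_3_iff by blast

lemma cubic_saturated_wf: "cubic_saturated G \<Longrightarrow> pair_wf_digraph G"
  unfolding cubic_saturated_def pair_wf_iff saturated_def by blast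

lemma two_weight:
  assumes "cubic_saturated G"
  shows "2 * weight G = 6 * int (card (pverts G)) - int (ec (adj G) (pverts G) (pverts G))"
proof -
  have "int (2 * num_edges G) = int (ec (adj G) (pverts G) (pverts G))"
    using two_num_edges[of G] assms unfolding cubic_saturated_def by simp
  then show ?thesis by (simp add: weight_def)
qed

section \<open>The upper bound 15, and transfer along isomorphisms\<close>

lemma cubic_vertex_exists:
  assumes "saturated V E" "v \<in> V" "nb E v V = 3"
  obtains a b c where "cubic_vertex V E v a b c"
proof -
  interpret saturated V E by (rule assms)
  obtain a b c where abc: "{w \<in> V. E v w} = {a, b, c}" "a \<noteq> b" "a \<noteq> c" "b \<noteq> c"
    using assms(3) unfolding nb_def card_3_iff by blast
  have "E v u \<longleftrightarrow> u = a \<or> u = b \<or> u = c" for u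
    using abc(1) Edom symD[of v u] unfolding set_eq_iff by auto
  then have "cubic_vertex V E v a b c"
    using assms abc by unfold_locales auto
  then show ?thesis by (rule that)
qed

lemma bound_vertex:
  assumes "saturated V E" "\<And>w. w \<in> V \<Longrightarrow> 3 \<le> nb E w V" "v \<in> V" "nb E v V = 3"
  shows "6 * card V < ec E V V + 30 \<or> (\<exists>a b c. cubic_vertex V E v a b c \<and> cubic_vertex.tight V E v a b c)"
proof -
  obtain a b c where "cubic_vertex V E v a b c" using cubic_vertex_exists assms by metis
  then interpret cubic_vertex V E v a b c .
  show ?thesis using bound assms(2) by blast
qed

lemma weight_le_15:
  assumes "cubic_saturated G"
  shows "weight G \<le> 15"
proof -
  obtain v where v: "v \<in> pverts G" "nb (adj G) v (pverts G) = 3"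
    and sat: "saturated (pverts G) (adj G)" and min3: "\<And>v. v \<in> pverts G \<Longrightarrow> 3 \<le> nb (adj G) v (pverts G)"
    using assms unfolding cubic_saturated_def by blast
  have "6 * card (pverts G) \<le> ec (adj G) (pverts G) (pverts G) + 30"
  proof -
    from sat min3 v have "6 * card (pverts G) < ec (adj G) (pverts G) (pverts G) + 30 \<or>
      (\<exists>a b c. cubic_vertex (pverts G) (adj G) v a b c \<and> cubic_vertex.tight (pverts G) (adj G) v a b c)"
      by (rule bound_vertex)
    then show ?thesis by (elim disjE exE conjE) (simp_all add: cubic_vertex.tight_def)
  qed
  then show ?thesis using two_weight[OF assms] by linarith
qed

text \<open>If \<open>x\<close> had degree 3, then as base vertex of an extremal graph each of its neighbours would have a
  neighbour not shared with the other two, which fails for the twins.\<close>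

lemma twin_neighbour_degree:
  assumes sat: "saturated V E" and min3: "\<And>w. w \<in> V \<Longrightarrow> 3 \<le> nb E w V"
    and eq: "6 * card V = ec E V V + 30"
    and twins: "u \<noteq> w" "{x. E u x} = {x. E w x}" and x: "E w x"
  shows "4 \<le> nb E x V"
proof (rule ccontr)
  interpret saturated V E by (rule sat)
  assume "\<not> ?thesis"
  moreover have "x \<in> V" using x symD Edom by blast
  ultimately have "nb E x V = 3" using min3[of x] by linarith
  from bound_vertex[OF sat min3 \<open>x \<in> V\<close> this] eq
  obtain a b c where "cubic_vertex V E x a b c" and t: "cubic_vertex.tight V E x a b c" by auto
  then interpret cubic_vertex V E x a b c by blast
  have e: "AB = {}" "AC = {}" "BC = {}" using t unfolding tight_def by blast+
  have ne: "A \<noteq> {}" "B \<noteq> {}" "C \<noteq> {}" using t mixed_cells[OF e] unfolding tight_def by blast+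
  have tw: "E u p \<longleftrightarrow> E w p" for p using twins(2) unfolding set_eq_iff by simp
  have "E x w" "E x u" using x tw symD by blast+
  then have "u = a \<or> u = b \<or> u = c" "w = a \<or> w = b \<or> w = c" using nbs by blast+
  moreover obtain p q r where "p \<in> A" "q \<in> B" "r \<in> C" using ne by blast
  ultimately show False using tw[of p] tw[of q] tw[of r] twins(1) distinct unfolding mem_cell by auto
qed

text \<open>Both \<open>c33\<close> and \<open>C33\<close> quantify over graphs on
  \<open>nat\<close>, so graphs built on other vertex types have to be copied there.\<close>

lemma graph_copy:
  assumes "finite V" "\<And>x y. E x y \<Longrightarrow> x \<in> V \<and> y \<in> V"
  obtains f and H :: "nat pair_pre_digraph" where "adj_iso f V E (pverts H) (adj H)" "pair_wf_digraph H"
proof -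
  obtain f where f: "bij_betw f V {0..<card V}" using ex_bij_betw_finite_nat[OF assms(1)] by blast
  define H where "H = \<lparr>pverts = {0..<card V}, parcs = {(f x, f y) |x y. E x y}\<rparr>"
  have "E x y \<longleftrightarrow> adj H (f x) (f y)" if "x \<in> V" "y \<in> V" for x y
    using that bij_betw_imp_inj_on[OF f] assms(2) by (auto simp: H_def dest: inj_onD)
  then have "adj_iso f V E (pverts H) (adj H)" using f by (simp add: adj_iso_def H_def)
  moreover have "pair_wf_digraph H"
    using assms(2) bij_betw_apply[OF f] by (auto simp: pair_wf_iff H_def)
  ultimately show ?thesis by (rule that)
qed

lemma cubic_saturated_adj_iso:
  assumes iso: "adj_iso f V E (pverts H) (adj H)" and wf: "pair_wf_digraph H"
    and sat: "saturated V E" "\<exists>v\<in>V. nb E v V = 3" "\<forall>v\<in>V. 3 \<le> nb E v V"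
  shows "cubic_saturated H" "2 * weight H = 6 * int (card V) - int (ec E V V)"
proof -
  have im: "pverts H = f ` V" using iso by (auto simp: adj_iso_def bij_betw_def)
  show H: "cubic_saturated H"
    unfolding cubic_saturated_def
  proof (intro conjI)
    show "saturated (pverts H) (adj H)"
      by (rule saturated_adj_iso[OF iso sat(1)]) (use wf in \<open>auto simp: pair_wf_iff\<close>)
    show "\<exists>v\<in>pverts H. nb (adj H) v (pverts H) = 3"
      using sat(2) nb_adj_iso[OF iso] im by auto
    show "\<forall>v\<in>pverts H. 3 \<le> nb (adj H) v (pverts H)"
      using sat(3) nb_adj_iso[OF iso] im by auto
  qed
  show "2 * weight H = 6 * int (card V) - int (ec E V V)"
    using two_weight[OF H] card_adj_iso[OF iso] ec_adj_iso[OF iso] by simp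
qed

lemma cubic_saturated_iso:
  assumes "graph_iso G H" "cubic_saturated H"
  shows "cubic_saturated G" "weight G = weight H"
proof -
  obtain f where wf: "pair_wf_digraph G" and "adj_iso f (pverts G) (adj G) (pverts H) (adj H)"
    using assms(1) unfolding graph_iso_iff by blast
  note * = cubic_saturated_adj_iso[OF adj_iso_inv[OF this(2)] wf]
  show "cubic_saturated G" using * assms(2) unfolding cubic_saturated_def by blast
  show "weight G = weight H" using * two_weight[OF assms(2)] assms(2) unfolding cubic_saturated_def by simp
qed

section \<open>The graphs with vertices \<open>s, x, y, z\<close>\<close>

lemma sxyz_verts_mem:
  "Vs \<in> pverts (sxyz_graph n)" "Vx i \<in> pverts (sxyz_graph n) \<longleftrightarrow> i \<in> {1..n}"
  "Vy i \<in> pverts (sxyz_graph n) \<longleftrightarrow> i \<in> {1..n}" "Vz i \<in> pverts (sxyz_graph n) \<longleftrightarrow> i \<in> {1..n}"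
  by (auto simp: sxyz_verts)

lemma sxyz_wf: "pair_wf_digraph (sxyz_graph n)"
  unfolding pair_wf_iff
proof (intro allI impI)
  fix u w assume "adj (sxyz_graph n) u w"
  then show "u \<in> pverts (sxyz_graph n) \<and> w \<in> pverts (sxyz_graph n)"
    by (cases u; cases w; simp only: sxyz_arcs sxyz_verts_mem; simp)
qed

lemma sxyz_saturated:
  assumes "3 \<le> n"
  shows "saturated (pverts (sxyz_graph n)) (adj (sxyz_graph n))"
proof
  let ?V = "pverts (sxyz_graph n)" and ?E = "adj (sxyz_graph n)"
  show "finite ?V" by (simp add: sxyz_verts)
  show "?E u v \<longleftrightarrow> ?E v u" for u v
    by (cases u; cases v; simp only: sxyz_arcs; blast)
  show "?E u v \<Longrightarrow> u \<in> ?V" for u v using sxyz_wf[of n] unfolding pair_wf_iff by blast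
  show "?E u v \<Longrightarrow> ?E v w \<Longrightarrow> ?E u w \<Longrightarrow> False" for u v w
    by (cases u; cases v; cases w; simp only: sxyz_arcs; blast)
  \<comment> \<open>Two distinct vertices \<open>Vy i\<close> and \<open>Vy j\<close> have
    \<open>Vz l\<close> as common neighbour for a third index \<open>l\<close>; this uses
    \<open>3 \<le> n\<close>.\<close>
  have "\<exists>l. l \<in> {1..n} \<and> l \<noteq> i \<and> l \<noteq> j" for i j :: nat
  proof -
    have "card {i, j} < card {1..n}" using assms card_insert_le_m1[of 2 "{j}" i] by simp
    then have "\<not> {1..n} \<subseteq> {i, j}" using card_mono[of "{i, j}" "{1..n}"] by auto
    then show ?thesis by blast
  qed
  then obtain k where k: "\<And>i j. k i j \<in> {1..n}" "\<And>i j. k i j \<noteq> i" "\<And>i j. k i j \<noteq> j" by metis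
  show "\<exists>t. ?E u t \<and> ?E w t" if u: "u \<in> ?V" "w \<in> ?V" "u \<noteq> w" "\<not> ?E u w" for u w
  proof -
    \<comment> \<open>The default \<open>Vs\<close> is a genuine common neighbour for two
      \<open>Vx\<close> vertices; the other pairs it covers are equal or adjacent.\<close>
    define t where "t = (case u of
        Vs \<Rightarrow> (case w of Vy i \<Rightarrow> Vx i | Vz i \<Rightarrow> Vx i | _ \<Rightarrow> Vs)
      | Vx i \<Rightarrow> (case w of Vy j \<Rightarrow> Vz i | Vz j \<Rightarrow> Vy i | _ \<Rightarrow> Vs)
      | Vy i \<Rightarrow> (case w of Vs \<Rightarrow> Vx i | Vx j \<Rightarrow> Vz j | Vy j \<Rightarrow> Vz (k i j) | Vz j \<Rightarrow> Vx i)
      | Vz i \<Rightarrow> (case w of Vs \<Rightarrow> Vx i | Vx j \<Rightarrow> Vy j | Vz j \<Rightarrow> Vy (k i j) | Vy j \<Rightarrow> Vx i))"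
    have "?E u t \<and> ?E w t"
      unfolding t_def using u
      by (cases u; cases w; simp only: sxyz.case sxyz_arcs sxyz_verts_mem; insert k k(2,3)[symmetric]; auto)
    then show ?thesis by blast
  qed
qed

lemma sxyz_nb:
  "nb (adj (sxyz_graph n)) Vs (pverts (sxyz_graph n)) = n"
  "i \<in> {1..n} \<Longrightarrow> nb (adj (sxyz_graph n)) (Vx i) (pverts (sxyz_graph n)) = 3"
  "i \<in> {1..n} \<Longrightarrow> nb (adj (sxyz_graph n)) (Vy i) (pverts (sxyz_graph n)) = n"
  "i \<in> {1..n} \<Longrightarrow> nb (adj (sxyz_graph n)) (Vz i) (pverts (sxyz_graph n)) = n"
proof -
  let ?N = "\<lambda>u. {w \<in> pverts (sxyz_graph n). adj (sxyz_graph n) u w}"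
  have inj: "inj_on Vx X" "inj_on Vy X" "inj_on Vz X" for X by (simp_all add: inj_on_def)
  have "w \<in> ?N Vs \<longleftrightarrow> w \<in> Vx ` {1..n}" for w
    by (cases w) (auto simp: sxyz_verts_mem sxyz_arcs)
  then have "?N Vs = Vx ` {1..n}" by (rule set_eqI)
  then show "nb (adj (sxyz_graph n)) Vs (pverts (sxyz_graph n)) = n"
    unfolding nb_def by (simp only: card_image inj) simp
  assume i: "i \<in> {1..n}"
  have "w \<in> ?N (Vx i) \<longleftrightarrow> w \<in> {Vs, Vy i, Vz i}" for w
    using i by (cases w) (auto simp: sxyz_verts_mem sxyz_arcs)
  then have "?N (Vx i) = {Vs, Vy i, Vz i}" by (rule set_eqI)
  then show "nb (adj (sxyz_graph n)) (Vx i) (pverts (sxyz_graph n)) = 3"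
    unfolding nb_def by (simp only:) simp
  have card: "card (insert (Vx i) (f ` ({1..n} - {i}))) = n"
    if "inj_on f ({1..n} - {i})" "Vx i \<notin> f ` ({1..n} - {i})" for f
    using i that by (simp add: card_image)
  have "w \<in> ?N (Vy i) \<longleftrightarrow> w \<in> insert (Vx i) (Vz ` ({1..n} - {i}))" for w
    using i by (cases w) (auto simp: sxyz_verts_mem sxyz_arcs)
  then have "?N (Vy i) = insert (Vx i) (Vz ` ({1..n} - {i}))" by (rule set_eqI)
  moreover have "Vx i \<notin> Vz ` ({1..n} - {i})" by blast
  ultimately show "nb (adj (sxyz_graph n)) (Vy i) (pverts (sxyz_graph n)) = n"
    unfolding nb_def using card[OF inj(3)] by (simp only: simp_thms)
  have "w \<in> ?N (Vz i) \<longleftrightarrow> w \<in> insert (Vx i) (Vy ` ({1..n} - {i}))" for w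
    using i by (cases w) (auto simp: sxyz_verts_mem sxyz_arcs)
  then have "?N (Vz i) = insert (Vx i) (Vy ` ({1..n} - {i}))" by (rule set_eqI)
  moreover have "Vx i \<notin> Vy ` ({1..n} - {i})" by blast
  ultimately show "nb (adj (sxyz_graph n)) (Vz i) (pverts (sxyz_graph n)) = n"
    unfolding nb_def using card[OF inj(2)] by (simp only: simp_thms)
qed

lemma sum_sxyz_verts:
  "(\<Sum>w\<in>pverts (sxyz_graph n). f w) = f Vs + (\<Sum>i\<in>{1..n}. f (Vx i)) + (\<Sum>i\<in>{1..n}. f (Vy i)) + (\<Sum>i\<in>{1..n}. f (Vz i))"
proof -
  have inj: "inj_on Vx X" "inj_on Vy X" "inj_on Vz X" for X by (simp_all add: inj_on_def)
  let ?I = "{1..n}"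
  have V: "pverts (sxyz_graph n) = insert Vs (Vx ` ?I \<union> (Vy ` ?I \<union> Vz ` ?I))"
    unfolding sxyz_verts by blast
  have d: "Vs \<notin> Vx ` ?I \<union> (Vy ` ?I \<union> Vz ` ?I)" "Vx ` ?I \<inter> (Vy ` ?I \<union> Vz ` ?I) = {}" "Vy ` ?I \<inter> Vz ` ?I = {}"
    by auto
  have fin: "finite (Vx ` ?I)" "finite (Vy ` ?I)" "finite (Vz ` ?I)" by simp_all
  have "sum f (pverts (sxyz_graph n)) = f Vs + (sum f (Vx ` ?I) + (sum f (Vy ` ?I) + sum f (Vz ` ?I)))"
    unfolding V using d fin by (simp only: sum.insert sum.union_disjoint finite_Un simp_thms)
  then show ?thesis by (simp only: sum.reindex inj o_def ac_simps)
qed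

lemma cubic_saturated_sxyz:
  assumes "3 \<le> n"
  shows "cubic_saturated (sxyz_graph n)"
proof -
  have "3 \<le> nb (adj (sxyz_graph n)) w (pverts (sxyz_graph n))" if "w \<in> pverts (sxyz_graph n)" for w
    using that assms by (cases w) (simp_all add: sxyz_verts_mem sxyz_nb)
  moreover have "Vx 1 \<in> pverts (sxyz_graph n)" "nb (adj (sxyz_graph n)) (Vx 1) (pverts (sxyz_graph n)) = 3"
    using assms by (simp_all add: sxyz_verts_mem sxyz_nb)
  ultimately show ?thesis unfolding cubic_saturated_def using sxyz_saturated[OF assms] by blast
qed

text \<open>There are 3n + 1 vertices, and the degrees sum to 4n + 2n^2. The factored form shows
  that 15 is attained exactly for n = 3 and n = 4.\<close>

lemma weight_sxyz:
  assumes "3 \<le> n"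
  shows "weight (sxyz_graph n) = 15 - (int n - 3) * (int n - 4)"
proof -
  have "card (pverts (sxyz_graph n)) = 1 + 3 * n"
    using sum_sxyz_verts[of "\<lambda>_. 1 :: nat" n] by simp
  moreover have "ec (adj (sxyz_graph n)) (pverts (sxyz_graph n)) (pverts (sxyz_graph n)) = 4 * n + 2 * (n * n)"
    unfolding ec_def sum_sxyz_verts by (simp add: sxyz_nb)
  ultimately have "2 * weight (sxyz_graph n) = 6 * (1 + 3 * int n) - (4 * int n + 2 * (int n * int n))"
    using two_weight[OF cubic_saturated_sxyz[OF assms]] by simp
  then show ?thesis by (simp add: algebra_simps)
qed

text \<open>Adjacency to \<open>Vs\<close>, to one or to two of the \<open>Vx\<close> vertices, and
  to a \<open>Vy\<close> or \<open>Vz\<close> with index 1 or 2 tells the kinds of vertices apart.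
  The index of \<open>Vx i\<close> is read off from \<open>Vy i\<close>, that of \<open>Vy i\<close>
  and \<open>Vz i\<close> from \<open>Vx i\<close>.\<close>

lemma sxyz_twin_free:
  assumes n: "3 \<le> n" and u: "u \<in> pverts (sxyz_graph n)" "w \<in> pverts (sxyz_graph n)"
    and tw: "\<And>t. t \<in> pverts (sxyz_graph n) \<Longrightarrow> adj (sxyz_graph n) u t \<longleftrightarrow> adj (sxyz_graph n) w t"
  shows "u = w"
proof -
  have s: "adj (sxyz_graph n) u Vs \<longleftrightarrow> adj (sxyz_graph n) w Vs"
    and x: "\<And>i. i \<in> {1..n} \<Longrightarrow> adj (sxyz_graph n) u (Vx i) \<longleftrightarrow> adj (sxyz_graph n) w (Vx i)"
    and y: "\<And>i. i \<in> {1..n} \<Longrightarrow> adj (sxyz_graph n) u (Vy i) \<longleftrightarrow> adj (sxyz_graph n) w (Vy i)"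
    and z: "\<And>i. i \<in> {1..n} \<Longrightarrow> adj (sxyz_graph n) u (Vz i) \<longleftrightarrow> adj (sxyz_graph n) w (Vz i)"
    by (rule tw, simp add: sxyz_verts_mem)+
  have n123: "1 \<in> {1..n}" "2 \<in> {1..n}" "3 \<in> {1..n}" using n by auto
  note x3 = x[OF n123(1)] x[OF n123(2)]
  note y3 = y[OF n123(1)] y[OF n123(2)]
  note z3 = z[OF n123(1)] z[OF n123(2)]
  show ?thesis
  proof (cases u)
    case Vs
    have "adj (sxyz_graph n) w (Vx 1)" "adj (sxyz_graph n) w (Vx 2)"
      using x3 n123 unfolding Vs sxyz_arcs by blast+
    then show ?thesis unfolding Vs by (cases w; simp only: sxyz_arcs; simp)
  next
    case (Vx i)
    have "adj (sxyz_graph n) w Vs" "adj (sxyz_graph n) w (Vy i)"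
      using s y[of i] u(1) unfolding Vx sxyz_arcs sxyz_verts_mem by blast+
    then show ?thesis unfolding Vx by (cases w; simp only: sxyz_arcs; blast)
  next
    case (Vy i)
    have "adj (sxyz_graph n) w (Vx i)"
      using x[of i] u(1) unfolding Vy sxyz_arcs sxyz_verts_mem by blast
    moreover have "\<not> (adj (sxyz_graph n) w (Vx 1) \<and> adj (sxyz_graph n) w (Vx 2))"
      using x3 unfolding Vy sxyz_arcs by auto
    moreover have "adj (sxyz_graph n) w (Vz 1) \<or> adj (sxyz_graph n) w (Vz 2)"
      using z3 u(1) n123 unfolding Vy sxyz_arcs sxyz_verts_mem by auto
    ultimately show ?thesis using n123 unfolding Vy
      by (cases w; simp only: sxyz_arcs; blast)
  next
    case (Vz i)
    have "adj (sxyz_graph n) w (Vx i)"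
      using x[of i] u(1) unfolding Vz sxyz_arcs sxyz_verts_mem by blast
    moreover have "\<not> (adj (sxyz_graph n) w (Vx 1) \<and> adj (sxyz_graph n) w (Vx 2))"
      using x3 unfolding Vz sxyz_arcs by auto
    moreover have "adj (sxyz_graph n) w (Vy 1) \<or> adj (sxyz_graph n) w (Vy 2)"
      using y3 u(1) n123 unfolding Vz sxyz_arcs sxyz_verts_mem by auto
    ultimately show ?thesis using n123 unfolding Vz
      by (cases w; simp only: sxyz_arcs; blast)
  qed
qed

section \<open>Blow-ups\<close>

text \<open>Where \<open>w\<close> was a common neighbour, its twin \<open>u\<close> takes over. The
  neighbours of \<open>w\<close> keep degree at least 3 by \<open>twin_neighbour_degree\<close>, and
  losing one vertex and three edges preserves the equality.\<close>

lemma saturated_remove_twin: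
  assumes sat: "saturated V E" and min3: "\<And>x. x \<in> V \<Longrightarrow> 3 \<le> nb E x V"
    and eq: "6 * card V = ec E V V + 30"
    and twins: "u \<in> V" "w \<in> V" "u \<noteq> w" "{x. E u x} = {x. E w x}" "card {x. E u x} = 3"
    and V': "V' = V - {w}" and E': "E' = (\<lambda>x y. E x y \<and> x \<in> V' \<and> y \<in> V')"
  shows "saturated V' E'" "x \<in> V' \<Longrightarrow> 3 \<le> nb E' x V'" "nb E' u V' = 3" "6 * card V' = ec E' V' V' + 30"
proof -
  interpret saturated V E by (rule sat)
  have tw: "E u x \<longleftrightarrow> E w x" "E x u \<longleftrightarrow> E x w" for x
    using twins(4) symD unfolding set_eq_iff by (simp, metis mem_Collect_eq)
  have uw: "\<not> E u w" using tw irrefl by blast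
  have uV': "u \<in> V'" and fin: "finite V'" and V: "V = V' \<union> {w}" "V' \<inter> {w} = {}"
    using twins by (auto simp: V')
  show "saturated V' E'"
  proof
    show "finite V'" by (rule fin)
    show "E' x y \<longleftrightarrow> E' y x" for x y using symD E' by blast
    show "E' x y \<Longrightarrow> x \<in> V'" for x y using E' by blast
    show "E' x y \<Longrightarrow> E' y z \<Longrightarrow> E' x z \<Longrightarrow> False" for x y z using E' triangle by blast
    show "\<exists>t. E' x t \<and> E' y t" if xy: "x \<in> V'" "y \<in> V'" "x \<noteq> y" "\<not> E' x y" for x y
    proof -
      have "x \<in> V" "y \<in> V" "\<not> E x y" using xy by (auto simp: V' E')
      then obtain t where t: "E x t" "E y t" using common xy(3) by blast
      then have "t \<in> V" using symD Edom by blast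
      show ?thesis
      proof (cases "t = w")
        case True
        then have "E x u" "E y u" using t tw by blast+
        then show ?thesis using xy uV' E' by blast
      next
        case False
        then show ?thesis using t xy \<open>t \<in> V\<close> E' V' by blast
      qed
    qed
  qed
  have nb': "nb E' x V' = nb E x V'" if "x \<in> V'" for x
    unfolding nb_def E' using that by (intro arg_cong[where f = card]) auto
  have split: "nb E x V = nb E x V' + nb E x {w}" for x
    using nb_Un[OF fin _ V(2), of E x] V(1) by simp
  have "nb E u V = 3" "nb E w V = 3"
  proof -
    have "{y \<in> V. E x y} = {y. E x y}" for x using symD Edom by blast
    then show "nb E u V = 3" "nb E w V = 3" using twins(4,5) by (simp_all add: nb_def)
  qed
  moreover have nbw: "nb E u {w} = 0" "nb E w {w} = 0" using uw irrefl by (auto intro: nb_none)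
  ultimately have uw3: "nb E u V' = 3" "nb E w V' = 3" using split[of u] split[of w] by simp_all
  show "nb E' u V' = 3" using uw3 nb'[OF uV'] by simp
  show "3 \<le> nb E' x V'" if x: "x \<in> V'" for x
  proof (cases "E w x")
    case True
    have "4 \<le> nb E x V" by (rule twin_neighbour_degree[OF sat min3 eq twins(3,4) True])
    moreover have "nb E x {w} \<le> card {w}" by (rule nb_le_card) simp
    ultimately show ?thesis using split[of x] nb'[OF x] by simp
  next
    case False
    then have "nb E x {w} = 0" using symD by (intro nb_none) blast
    moreover have "x \<in> V" using x by (simp add: V')
    ultimately show ?thesis using min3[of x] split[of x] nb'[OF x] by simp
  qed
  have "ec E' V' V' = ec E V' V'" unfolding ec_def using nb' by simp
  moreover have "ec E V V = ec E V' V' + ec E V' {w} + (ec E {w} V' + ec E {w} {w})"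
    using ec_Un_left[OF fin _ V(2), of E V] ec_Un_right[OF fin _ V(2), of E V'] ec_Un_right[OF fin _ V(2), of E "{w}"] V(1)
    by simp
  moreover have "ec E V' {w} = ec E {w} V'" using fin Esym by (intro ec_commute) auto
  moreover have "ec E {w} V' = 3" "ec E {w} {w} = 0" using uw3 nbw by (simp_all add: ec_def)
  moreover have "card V' + 1 = card V" using card.remove[OF finV twins(2)] by (simp add: V')
  ultimately show "6 * card V' = ec E' V' V' + 30" using eq by linarith
qed

section \<open>The value of \<open>c33\<close> and the extremal graphs\<close>

lemma c33_eq: "c33 = 15"
proof -
  \<comment> \<open>The Petersen graph attains 15; the witness for \<open>c33\<close> is a copy of
    it on natural numbers.\<close>
  obtain f and H :: "nat pair_pre_digraph"
    where H: "adj_iso f (pverts (sxyz_graph 3)) (adj (sxyz_graph 3)) (pverts H) (adj H)" "pair_wf_digraph H"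
  proof (rule graph_copy)
    show "finite (pverts (sxyz_graph 3))" by (simp add: sxyz_verts)
    show "adj (sxyz_graph 3) x y \<Longrightarrow> x \<in> pverts (sxyz_graph 3) \<and> y \<in> pverts (sxyz_graph 3)" for x y
      using sxyz_wf[of 3] unfolding pair_wf_iff by blast
  qed
  have "graph_iso H (sxyz_graph 3)"
    unfolding graph_iso_iff using H sxyz_wf adj_iso_inv by blast
  then have "cubic_saturated H" "weight H = 15"
    using cubic_saturated_iso[of H "sxyz_graph 3"] cubic_saturated_sxyz[of 3] weight_sxyz[of 3] by simp_all
  then show ?thesis
    unfolding c33_def conj_assoc[symmetric] cubic_saturated_iff[symmetric]
    using weight_le_15 by (intro Greatest_equality) auto
qed

definition proper_blow_up :: "'a pair_pre_digraph \<Rightarrow> nat pair_pre_digraph \<Rightarrow> nat set \<Rightarrow> bool" where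
  "proper_blow_up G H S \<longleftrightarrow> card (pverts H) < card (pverts G) \<and> S \<subseteq> pverts H \<and>
    (\<forall>u\<in>S. \<forall>v\<in>S. (u, v) \<notin> parcs H) \<and> (\<forall>v\<in>S. degree H v = 3) \<and> blow_up_of_set G H S"

lemma C33_iff:
  "G \<in> C33 \<longleftrightarrow> cubic_saturated G \<and> weight G = 15 \<and>
    \<not> (\<exists>H S. cubic_saturated H \<and> weight H = 15 \<and> proper_blow_up G H S)"
proof -
  have w: "int (num_edges K) = 3 * int (card (pverts K)) - c33 \<longleftrightarrow> weight K = 15" for K :: "'b pair_pre_digraph"
    unfolding weight_def c33_eq by linarith
  show ?thesis
    unfolding C33_def mem_Collect_eq proper_blow_up_def cubic_saturated_iff w by (simp only: conj_assoc)
qed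

lemma weight_15_iff:
  assumes "cubic_saturated G"
  shows "weight G = 15 \<longleftrightarrow> 6 * card (pverts G) = ec (adj G) (pverts G) (pverts G) + 30"
  using two_weight[OF assms] by linarith

text \<open>\<open>H\<close> is a copy of \<open>G\<close> without \<open>w\<close>, and doubling
  the single vertex \<open>f u\<close> gives \<open>G\<close> back.\<close>

lemma twins_imp_proper_blow_up:
  assumes G: "cubic_saturated G" "weight G = 15"
    and twins: "u \<in> pverts G" "w \<in> pverts G" "u \<noteq> w"
      "{x. adj G u x} = {x. adj G w x}" "card {x. adj G u x} = 3"
  shows "\<exists>H S. cubic_saturated H \<and> weight H = 15 \<and> proper_blow_up G H S"
proof -
  let ?V = "pverts G" and ?E = "adj G"
  define V' where "V' = ?V - {w}"
  define E' where "E' = (\<lambda>x y. ?E x y \<and> x \<in> V' \<and> y \<in> V')"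
  have sat: "saturated ?V ?E" and min3: "\<And>x. x \<in> ?V \<Longrightarrow> 3 \<le> nb ?E x ?V"
    using G(1) unfolding cubic_saturated_def by blast+
  interpret saturated ?V ?E by (rule sat)
  note eq = G(2)[unfolded weight_15_iff[OF G(1)]]
  note rem = saturated_remove_twin[OF sat min3 eq twins V'_def E'_def]
  have "finite V'" by (simp add: V'_def)
  then obtain f and H :: "nat pair_pre_digraph" where iso: "adj_iso f V' E' (pverts H) (adj H)" and wf: "pair_wf_digraph H"
    by (rule graph_copy[of V' E']) (simp add: E'_def)
  have uV': "u \<in> V'" using twins by (simp add: V'_def)
  have fV': "f ` V' = pverts H" "inj_on f V'" using iso by (auto simp: adj_iso_def bij_betw_def)
  have fE: "adj H (f x) (f y) \<longleftrightarrow> E' x y" if "x \<in> V'" "y \<in> V'" for x y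
    using iso that by (simp add: adj_iso_def)
  have H: "cubic_saturated H" "2 * weight H = 6 * int (card V') - int (ec E' V' V')"
    using cubic_saturated_adj_iso[OF iso wf rem(1)] rem(2,3) uV' by blast+
  then have wH: "weight H = 15" using rem(4) by linarith
  define m where "m = (\<lambda>x. if x = f u then 2 else 1 :: nat)"
  \<comment> \<open>\<open>r\<close> folds \<open>w\<close> onto its twin, and the second component
    of \<open>g\<close> separates the two copies of \<open>f u\<close>.\<close>
  define r where "r = (\<lambda>x. if x = w then u else x)"
  define g where "g = (\<lambda>x. (f (r x), if x = w then 1 else 0 :: nat))"
  have r: "r x \<in> V'" if "x \<in> ?V" for x using that uV' by (auto simp: r_def V'_def)
  have mem: "p \<in> pverts (blow_up m H) \<longleftrightarrow> fst p \<in> pverts H \<and> snd p < m (fst p)" for p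
    by (cases p) (simp add: blow_up_def)
  have adjB: "adj (blow_up m H) p q \<longleftrightarrow> adj H (fst p) (fst q) \<and> snd p < m (fst p) \<and> snd q < m (fst q)" for p q
    by (cases p; cases q) (simp add: blow_up_def)
  have gm: "snd (g x) < m (fst (g x))" if "x \<in> ?V" for x
    by (simp add: g_def m_def r_def)
  have tw: "?E (r x) (r y) \<longleftrightarrow> ?E x y" for x y
    using twins(4) symD unfolding r_def set_eq_iff by (simp, metis)
  have "inj_on g ?V"
  proof (rule inj_onI)
    fix x y assume x: "x \<in> ?V" and y: "y \<in> ?V" and eq: "g x = g y"
    have "r x = r y" using eq inj_onD[OF fV'(2) _ r[OF x] r[OF y]] by (simp add: g_def)
    then show "x = y" using eq by (auto simp: g_def r_def split: if_splits)
  qed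
  moreover have "g ` ?V = pverts (blow_up m H)"
  proof (intro equalityI subsetI)
    fix p assume "p \<in> g ` ?V"
    then show "p \<in> pverts (blow_up m H)" using gm r fV'(1) by (auto simp: mem g_def)
  next
    fix p assume "p \<in> pverts (blow_up m H)"
    then obtain x where x: "x \<in> V'" "fst p = f x" and i: "snd p < m (f x)" using fV'(1) unfolding mem by force
    have xw: "x \<noteq> w" "x \<in> ?V" using x by (auto simp: V'_def)
    show "p \<in> g ` ?V"
    proof (cases "snd p = 0")
      case True
      then have "p = g x" using x xw by (simp add: g_def r_def prod_eq_iff)
      then show ?thesis using xw by blast
    next
      case False
      then have "f x = f u" "snd p = 1" using i by (auto simp: m_def split: if_splits)
      then have "p = g w" using x by (simp add: g_def r_def prod_eq_iff)
      then show ?thesis using twins(2) by blast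
    qed
  qed
  moreover have "?E x y \<longleftrightarrow> adj (blow_up m H) (g x) (g y)" if "x \<in> ?V" "y \<in> ?V" for x y
    using tw[of x y] fE[OF r r] r gm that by (simp add: adjB E'_def) (simp add: g_def)
  ultimately have "adj_iso g ?V ?E (pverts (blow_up m H)) (adj (blow_up m H))"
    by (simp add: adj_iso_def bij_betw_def)
  moreover have "pair_wf_digraph (blow_up m H)"
    using wf unfolding pair_wf_iff mem adjB by blast
  ultimately have "graph_iso G (blow_up m H)"
    using cubic_saturated_wf[OF G(1)] unfolding graph_iso_iff by blast
  then have "blow_up_of_set G H {f u}"
    unfolding blow_up_of_set_def by (intro exI[of _ m]) (simp add: m_def)
  moreover have "card (pverts H) < card ?V"
    using card_adj_iso[OF iso] card.remove[OF finV twins(2)] by (simp add: V'_def)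
  moreover have "degree H (f u) = 3"
    using degree_eq_nb[OF wf] nb_adj_iso[OF iso uV'] rem(3) by simp
  moreover have "\<not> adj H (f u) (f u)" using fE[OF uV' uV'] irrefl by (simp add: E'_def)
  ultimately have "proper_blow_up G H {f u}" using uV' fV'(1) unfolding proper_blow_up_def by blast
  then show ?thesis using H(1) wH by blast
qed

text \<open>The multiplicities sum to more than the number of vertices of \<open>H\<close>, so one
  is at least 2; copies 0 and 1 of that vertex are the twins.\<close>

lemma proper_blow_up_imp_twins:
  assumes "proper_blow_up G H S" "cubic_saturated H"
  shows "\<exists>p\<in>pverts G. \<exists>q\<in>pverts G. p \<noteq> q \<and> (\<forall>t\<in>pverts G. adj G p t \<longleftrightarrow> adj G q t)"
proof -
  obtain m where m: "\<forall>v\<in>pverts H. 0 < m v" and "graph_iso G (blow_up m H)"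
    and less: "card (pverts H) < card (pverts G)"
    using assms(1) unfolding proper_blow_up_def blow_up_of_set_def by blast
  then obtain f where f: "adj_iso f (pverts G) (adj G) (pverts (blow_up m H)) (adj (blow_up m H))"
    unfolding graph_iso_iff by blast
  have fin: "finite (pverts H)" using assms(2) unfolding cubic_saturated_def saturated_def by blast
  have "card (pverts G) = (\<Sum>v\<in>pverts H. m v)"
    using card_adj_iso[OF f] fin by (simp add: blow_up_def)
  have "\<exists>v\<in>pverts H. m v \<noteq> 1"
  proof (rule ccontr)
    assume "\<not> ?thesis"
    then have "(\<Sum>v\<in>pverts H. m v) = card (pverts H)" by simp
    then show False using less \<open>card (pverts G) = _\<close> by simp
  qed
  then obtain v where v: "v \<in> pverts H" "2 \<le> m v" using m by force
  let ?B = "blow_up m H"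
  have "(v, 0) \<in> pverts ?B" "(v, 1) \<in> pverts ?B" using v by (auto simp: blow_up_def)
  moreover have B: "f ` pverts G = pverts ?B" using f by (simp add: adj_iso_def bij_betw_def)
  ultimately obtain p q where pq: "p \<in> pverts G" "f p = (v, 0)" "q \<in> pverts G" "f q = (v, 1)"
    by (metis (no_types, lifting) imageE)
  have "adj G p t \<longleftrightarrow> adj G q t" if t: "t \<in> pverts G" for t
  proof -
    have "adj G p t \<longleftrightarrow> adj ?B (v, 0) (f t)" "adj G q t \<longleftrightarrow> adj ?B (v, 1) (f t)"
      using f pq t unfolding adj_iso_def by metis+
    then show ?thesis using v by (cases "f t") (simp add: blow_up_def)
  qed
  moreover have "p \<noteq> q" using pq by auto
  ultimately show ?thesis using pq by blast
qed

lemma C33_sxyz: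
  assumes iso: "graph_iso G (sxyz_graph n)" and n: "n = 3 \<or> n = 4"
  shows "G \<in> C33"
proof -
  have n3: "3 \<le> n" using n by auto
  have G: "cubic_saturated G" "weight G = weight (sxyz_graph n)"
    using cubic_saturated_iso[OF iso cubic_saturated_sxyz[OF n3]] by blast+
  have "\<not> proper_blow_up G H S" if H: "cubic_saturated H" for H S
  proof
    assume "proper_blow_up G H S"
    then obtain p q where pq: "p \<in> pverts G" "q \<in> pverts G" "p \<noteq> q"
      and tw: "\<And>t. t \<in> pverts G \<Longrightarrow> adj G p t \<longleftrightarrow> adj G q t"
      using proper_blow_up_imp_twins[OF _ H] by blast
    obtain f where "adj_iso f (pverts G) (adj G) (pverts (sxyz_graph n)) (adj (sxyz_graph n))"
      using iso unfolding graph_iso_iff by blast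
    then have f: "f ` pverts G = pverts (sxyz_graph n)" "inj_on f (pverts G)"
      and E: "\<And>x y. x \<in> pverts G \<Longrightarrow> y \<in> pverts G \<Longrightarrow> adj G x y \<longleftrightarrow> adj (sxyz_graph n) (f x) (f y)"
      by (auto simp: adj_iso_def bij_betw_def)
    have "f p = f q"
    proof (rule sxyz_twin_free[OF n3])
      show "f p \<in> pverts (sxyz_graph n)" "f q \<in> pverts (sxyz_graph n)" using f pq by blast+
      fix t assume "t \<in> pverts (sxyz_graph n)"
      then obtain s where "s \<in> pverts G" "t = f s" using f(1) by blast
      then show "adj (sxyz_graph n) (f p) t \<longleftrightarrow> adj (sxyz_graph n) (f q) t"
        using tw E pq by blast
    qed
    then show False using f(2) pq by (auto dest: inj_onD)
  qed
  moreover have "weight G = 15" using G(2) weight_sxyz[OF n3] n by auto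
  ultimately show ?thesis unfolding C33_iff using G(1) by blast
qed

text \<open>Twins of degree 3 would make \<open>G\<close> a proper blow-up, so
  \<open>sxyz_structure\<close> applies, and weight 15 leaves only the roots 3 and 4 of the
  quadratic in \<open>weight_sxyz\<close>.\<close>

lemma C33_imp_sxyz:
  assumes "G \<in> C33"
  shows "graph_iso G (sxyz_graph 3) \<or> graph_iso G (sxyz_graph 4)"
proof -
  have G: "cubic_saturated G" "weight G = 15"
    and no: "\<not> (\<exists>H S. cubic_saturated H \<and> weight H = 15 \<and> proper_blow_up G H S)"
    using assms unfolding C33_iff by blast+
  let ?V = "pverts G" and ?E = "adj G"
  obtain v where v: "v \<in> ?V" "nb ?E v ?V = 3" and sat: "saturated ?V ?E"
    and min3: "\<And>x. x \<in> ?V \<Longrightarrow> 3 \<le> nb ?E x ?V"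
    using G(1) unfolding cubic_saturated_def by blast
  have "6 * card ?V = ec ?E ?V ?V + 30" using G weight_15_iff by blast
  then obtain a b c where abc: "cubic_vertex ?V ?E v a b c" "cubic_vertex.tight ?V ?E v a b c"
    using bound_vertex[OF sat min3 v] by auto
  have "tight_vertex ?V ?E v a b c"
    unfolding tight_vertex_def tight_vertex_axioms_def
    using abc no twins_imp_proper_blow_up[OF G] by blast
  from tight_vertex.sxyz_structure[OF this] obtain f n where n: "3 \<le> n" and "bij_betw f (pverts (sxyz_graph n)) ?V"
    "\<forall>u\<in>pverts (sxyz_graph n). \<forall>w\<in>pverts (sxyz_graph n). (u, w) \<in> parcs (sxyz_graph n) \<longleftrightarrow> ?E (f u) (f w)"
    by (elim exE conjE)
  then have "adj_iso f (pverts (sxyz_graph n)) (adj (sxyz_graph n)) ?V ?E" by (simp add: adj_iso_def)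
  then have iso: "graph_iso G (sxyz_graph n)"
    unfolding graph_iso_iff using adj_iso_inv sxyz_wf cubic_saturated_wf[OF G(1)] by blast
  then have "(int n - 3) * (int n - 4) = 0"
    using cubic_saturated_iso[OF iso cubic_saturated_sxyz[OF n]] weight_sxyz[OF n] G(2) by simp
  then have "n = 3 \<or> n = 4" by auto
  then show ?thesis using iso by blast
qed

theorem theorem14:
  shows "(C33 :: 'a pair_pre_digraph set) = {G. graph_iso G P_graph \<or> graph_iso G Q_graph}"
  unfolding P_graph_def Q_graph_def using C33_imp_sxyz C33_sxyz by blast

end
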